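(* Let $n\geq 19$ with $n\equiv 3\pmod 4$ and $r=(n-3)/2$. Let $V$ consist of the $n$ distinct vertices $p_1,p_2,p_3,p_4,y_2,\dots,y_{r+1},z_3,\dots,z_{r+1}$. Consider the labelled graph on $V$ with edges: $\{p_1,p_2\}$ with label $0$; $\{p_2,p_3\}$ with label $1$; $\{p_3,p_4\}$ with the two labels $0$ and $2$; $\{p_4,y_2\}$ with label $1$; $\{y_k,y_{k+1}\}$ with label $k$ for $2\leq k\leq r-1$; $\{y_r,y_{r+1}\}$ with label $r-2$; $\{z_k,z_{k+1}\}$ with label $k$ for $3\leq k\leq r-1$; $\{z_r,z_{r+1}\}$ with label $r-2$; and $\{y_j,z_j\}$ with label $r-4$ for $j\in\{r-2,r-1,r,r+1\}$. Then $G\cong A_n$ and $(G,(\rho_0,\dots,\rho_{r-1}))$ is a string C-group of rank $r$ with Schläfli type $\{5,5,6,3^{r-8},6,6,6,4\}$.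
   Context: A string group generated by involutions (sggi) of rank $r$ is a pair $(G,(\rho_0,\dots,\rho_{r-1}))$ where $\rho_0,\dots,\rho_{r-1}$ are involutions generating the group $G$ such that $(\rho_i\rho_j)^2=1$ whenever $|i-j|\geq 2$. It is a string C-group if in addition it satisfies the intersection property: for all $J,K\subseteq\{0,\dots,r-1\}$, $\langle \rho_j : j\in J\rangle\cap\langle\rho_k : k\in K\rangle=\langle \rho_j : j\in J\cap K\rangle$. The Schläfli type is $\{p_1,\dots,p_{r-1}\}$ where $p_i$ is the order of $\rho_{i-1}\rho_i$; $3^k$ denotes $k$ consecutive entries equal to $3$ (omitted if $k=0$). Labelled-graph convention: the vertex set $V$ is finite, and each edge $\{a,b\}$ ($a\neq b$) carries one or more labels from $\{0,\dots,r-1\}$, the edges carrying any given label being pairwise disjoint; $\rho_k$ denotes the permutation of $V$ equal to the product of the transpositions $(a\,b)$ over all edges $\{a,b\}$ carrying label $k$, and $G=\langle\rho_0,\dots,\rho_{r-1}\rangle\leq \mathrm{Sym}(V)$. *)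

theory Defs
  imports "HOL-Algebra.Algebra"
begin

datatype vtx = P nat | Y nat | Z nat

text \<open>Labelled graph: a set of pairs (edge, label). The permutation of label k
  swaps the two endpoints of each edge carrying label k (edges of a given label
  being pairwise disjoint) and fixes every other point.\<close>
definition label_perm :: "('a set \<times> nat) set \<Rightarrow> nat \<Rightarrow> 'a \<Rightarrow> 'a" where
  "label_perm E k v = (if \<exists>w. w \<noteq> v \<and> ({v, w}, k) \<in> E
                        then (THE w. w \<noteq> v \<and> ({v, w}, k) \<in> E) else v)"

definition Sym_on :: "'a set \<Rightarrow> ('a \<Rightarrow> 'a) monoid" where
  "Sym_on V = \<lparr> carrier = {p. p permutes V}, monoid.mult = (\<circ>), one = id \<rparr>"

definition perm_group_of :: "'a set \<Rightarrow> ('a set \<times> nat) set \<Rightarrow> nat \<Rightarrow> ('a \<Rightarrow> 'a) monoid" where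
  "perm_group_of V E r = (Sym_on V) \<lparr> carrier := generate (Sym_on V) (label_perm E ` {..<r}) \<rparr>"

definition sggi :: "('g, 'b) monoid_scheme \<Rightarrow> (nat \<Rightarrow> 'g) \<Rightarrow> nat \<Rightarrow> bool" where
  "sggi G rho r \<longleftrightarrow> group G
     \<and> (\<forall>i<r. rho i \<in> carrier G \<and> rho i \<noteq> \<one>\<^bsub>G\<^esub> \<and> rho i \<otimes>\<^bsub>G\<^esub> rho i = \<one>\<^bsub>G\<^esub>)
     \<and> generate G (rho ` {..<r}) = carrier G
     \<and> (\<forall>i<r. \<forall>j<r. i + 2 \<le> j \<longrightarrow> (rho i \<otimes>\<^bsub>G\<^esub> rho j) [^]\<^bsub>G\<^esub> (2::nat) = \<one>\<^bsub>G\<^esub>)"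

definition intersection_property :: "('g, 'b) monoid_scheme \<Rightarrow> (nat \<Rightarrow> 'g) \<Rightarrow> nat \<Rightarrow> bool" where
  "intersection_property G rho r \<longleftrightarrow>
     (\<forall>J K. J \<subseteq> {..<r} \<longrightarrow> K \<subseteq> {..<r} \<longrightarrow>
        generate G (rho ` J) \<inter> generate G (rho ` K) = generate G (rho ` (J \<inter> K)))"

definition string_C_group :: "('g, 'b) monoid_scheme \<Rightarrow> (nat \<Rightarrow> 'g) \<Rightarrow> nat \<Rightarrow> bool" where
  "string_C_group G rho r \<longleftrightarrow> sggi G rho r \<and> intersection_property G rho r"

definition schlafli :: "('g, 'b) monoid_scheme \<Rightarrow> (nat \<Rightarrow> 'g) \<Rightarrow> nat \<Rightarrow> nat list" where
  "schlafli G rho r = map (\<lambda>i. group.ord G (rho (i - 1) \<otimes>\<^bsub>G\<^esub> rho i)) [1..<r]"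

definition verts49 :: "nat \<Rightarrow> vtx set" where
  "verts49 r = {P 1, P 2, P 3, P 4} \<union> Y ` {2..r+1} \<union> Z ` {3..r+1}"

definition edges49 :: "nat \<Rightarrow> (vtx set \<times> nat) set" where
  "edges49 r =
     {({P 1, P 2}, 0), ({P 2, P 3}, 1), ({P 3, P 4}, 0), ({P 3, P 4}, 2), ({P 4, Y 2}, 1)}
   \<union> {({Y k, Y (k+1)}, k) | k. 2 \<le> k \<and> k \<le> r - 1}
   \<union> {({Y r, Y (r+1)}, r - 2)}
   \<union> {({Z k, Z (k+1)}, k) | k. 3 \<le> k \<and> k \<le> r - 1}
   \<union> {({Z r, Z (r+1)}, r - 2)}
   \<union> {({Y j, Z j}, r - 4) | j. j \<in> {r - 2, r - 1, r, r + 1}}"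

end

theory Submission
  imports Defs
begin

text \<open>Write \<open>r = q + 8\<close> and let \<open>W q J\<close> be the group generated by the involutions with labels in \<open>J\<close>.
  For a string of involutions the intersection property follows from the inclusions
  \<open>W q {..<b} \<inter> W q {a..<r} \<subseteq> W q {a..<b}\<close>. An element of the intersection on the left is even, and
  it inherits constraints from both ends of the string: membership in \<open>W q {a..<r}\<close> controls the points
  \<open>P i\<close> and, for \<open>a \<ge> 3\<close>, forces commutation with the swap of the \<open>Y\<close> and \<open>Z\<close> chains; membership in
  \<open>W q {..<b}\<close> controls the blocks \<open>{Y k, Z k}\<close> beyond \<open>b\<close>. Conversely the cubes of products of
  neighbouring generators provide enough elements of \<open>W q {a..<b}\<close> to generate everything that
  satisfies these constraints. Only \<open>W q {..<2}\<close>
  (dihedral of order 10) and \<open>W q {..<3}\<close> (\<open>PSL(2,5)\<close> on 6 points) are too small for this and need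
  coset enumeration.\<close>

section \<open>Intersection property from intervals\<close>

text \<open>All generators are even, so no \<open>W q J\<close> contains a single transposition, and
  generation by transpositions needs a substitute. This is \<open>linked\<close>: each transposition
  is multiplied by one fixed involution \<open>u\<close>, and an even permutation that moves points
  only inside linked classes is a product in which the copies of \<open>u\<close> cancel. The choice
  of \<open>u\<close> follows the group: \<open>transpose (P 3) (P 4)\<close> where the points
  \<open>P i\<close> move (it is a factor of the generators with labels 0 and 2 and of the cube at
  label 2), \<open>flip_on {m}\<close> for sign changes of blocks, and \<open>id\<close> for index
  permutations, whose action on both chains at once is even. The case split at b = q + 4, q + 5, q +
  6 comes from two features of the graph: the rungs \<open>{Y j, Z j}\<close> carry label q + 4
  although they sit at the far indices q + 6 to q + 9, and the last edge of each chain repeats label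
  q + 6. So an initial segment also acts beyond the index b + 1. That action is a group of order at
  most four, and it is divided out before the constraints from the two ends are compared.\<close>

inductive_set words :: "('a \<Rightarrow> 'a) set \<Rightarrow> ('a \<Rightarrow> 'a) set" for S where
  words_id: "id \<in> words S"
| words_step: "s \<in> S \<Longrightarrow> g \<in> words S \<Longrightarrow> s \<circ> g \<in> words S"

lemma words_base: "s \<in> S \<Longrightarrow> s \<in> words S"
  using words_step[OF _ words_id, of s S] by simp

lemma words_comp: "g \<in> words S \<Longrightarrow> h \<in> words S \<Longrightarrow> g \<circ> h \<in> words S"
  by (induction rule: words.induct) (auto simp: comp_assoc intro: words_step)

lemma words_mono: "S \<subseteq> T \<Longrightarrow> words S \<subseteq> words T"
proof
  fix g assume "S \<subseteq> T" "g \<in> words S"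
  from this(2,1) show "g \<in> words T"
    by (induction rule: words.induct) (auto intro: words.intros)
qed

lemma words_empty: "words {} = {id}"
  by (auto intro: words_id elim: words.cases)

lemma words_commute:
  assumes "\<And>s t. s \<in> S \<Longrightarrow> t \<in> T \<Longrightarrow> s \<circ> t = t \<circ> s"
    and "g \<in> words S" "h \<in> words T"
  shows "g \<circ> h = h \<circ> g"
proof -
  have 1: "s \<circ> h = h \<circ> s" if "s \<in> S" for s
    using assms(3)
  proof (induction rule: words.induct)
    case (words_step t h)
    then show ?case using assms(1)[OF that, of t] by (metis comp_assoc)
  qed simp
  show ?thesis using assms(2)
  proof (induction rule: words.induct)
    case (words_step s g)
    then show ?case using 1[of s] by (metis comp_assoc)
  qed simp
qed

lemma words_Un:
  assumes "\<And>s t. s \<in> S \<Longrightarrow> t \<in> T \<Longrightarrow> s \<circ> t = t \<circ> s" and "g \<in> words (S \<union> T)"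
  shows "\<exists>x\<in>words S. \<exists>y\<in>words T. g = x \<circ> y"
  using assms(2)
proof (induction rule: words.induct)
  case words_id
  show ?case by (metis comp_id words.words_id)
next
  case (words_step s g)
  then obtain x y where xy: "x \<in> words S" "y \<in> words T" "g = x \<circ> y" by blast
  show ?case
  proof (cases "s \<in> S")
    case True
    then show ?thesis using xy words.words_step[OF True xy(1)] by (metis comp_assoc)
  next
    case False
    then have sT: "s \<in> T" using words_step by blast
    have "s \<circ> x = x \<circ> s"
      using words_commute[OF assms(1) xy(1) words_base[OF sT]] by simp
    then show ?thesis using xy words.words_step[OF sT xy(2)] by (metis comp_assoc)
  qed
qed

lemma bij_comp_inv:
  assumes "bij f"
  shows "f \<circ> inv' f = id" "inv' f \<circ> f = id"
  using assms by (simp_all add: bij_is_surj bij_is_inj surj_iff[symmetric])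

text \<open>A predicate on sets, because the generation lemmas are applied not only to
  \<open>W q J\<close> but also to preimages of it: index permutations in \<open>lift_in\<close>, a
  conjugate subgroup in \<open>twisted_section_in\<close>.\<close>

definition perm_subgroup :: "('a \<Rightarrow> 'a) set \<Rightarrow> bool" where
  "perm_subgroup H \<longleftrightarrow> id \<in> H \<and> (\<forall>g\<in>H. \<forall>h\<in>H. g \<circ> h \<in> H) \<and> (\<forall>g\<in>H. bij g \<and> inv' g \<in> H)"

lemma perm_subgroupD:
  assumes "perm_subgroup H"
  shows "id \<in> H" "g \<in> H \<Longrightarrow> h \<in> H \<Longrightarrow> g \<circ> h \<in> H" "g \<in> H \<Longrightarrow> bij g" "g \<in> H \<Longrightarrow> inv' g \<in> H"
  using assms by (auto simp: perm_subgroup_def)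

text \<open>Reversing a word in involutions inverts it, so closing under multiplication already
  gives a group.\<close>

lemma perm_subgroup_words:
  assumes "\<And>s. s \<in> S \<Longrightarrow> s \<circ> s = id"
  shows "perm_subgroup (words S)"
proof -
  have "bij g \<and> inv' g \<in> words S" if "g \<in> words S" for g
    using that
  proof (induction rule: words.induct)
    case words_id
    show ?case by (metis bij_id inv_id words.words_id)
  next
    case (words_step s g)
    have ss: "s \<circ> s = id" using assms words_step by blast
    have "bij s" by (rule o_bij[OF ss ss])
    moreover have "inv' s = s" by (rule inv_unique_comp[OF ss ss])
    ultimately have "inv' (s \<circ> g) = inv' g \<circ> s" "bij (s \<circ> g)"
      using words_step by (auto simp: o_inv_distrib bij_comp)
    then show ?case using words_step words_comp words_base by metis
  qed
  then show ?thesis by (simp add: perm_subgroup_def words_id words_comp)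
qed

lemma cancel_left:
  assumes "perm_subgroup H" "e \<in> H" "e \<circ> g \<in> H"
  shows "g \<in> H"
proof -
  have "inv' e \<circ> (e \<circ> g) \<in> H" using assms perm_subgroupD by metis
  moreover have "inv' e \<circ> (e \<circ> g) = g"
    using perm_subgroupD(3)[OF assms(1,2)] by (simp add: fun_eq_iff bij_is_inj)
  ultimately show ?thesis by simp
qed

text \<open>Induction on the length of an interval containing \<open>J\<close> and \<open>K\<close>.
  If neither is the whole interval, each misses a label, and a group with a missing label splits as
  a direct product of the parts below and above it. Comparing the splittings of one element at the
  two missing labels leaves only factors in shorter intervals.\<close>

lemma intersection_from_intervals:
  fixes rho :: "nat \<Rightarrow> 'a \<Rightarrow> 'a"
  defines "W \<equiv> \<lambda>J. words (rho ` J)"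
  assumes invol: "\<And>k. k < r \<Longrightarrow> rho k \<circ> rho k = id"
    and comm: "\<And>i j. i + 2 \<le> j \<Longrightarrow> j < r \<Longrightarrow> rho i \<circ> rho j = rho j \<circ> rho i"
    and wedge: "\<And>a b. a \<le> r \<Longrightarrow> b \<le> r \<Longrightarrow> W {..<b} \<inter> W {a..<r} \<subseteq> W {a..<b}"
  assumes "J \<subseteq> {a..<b}" "K \<subseteq> {a..<b}" "b \<le> r"
  shows "W J \<inter> W K \<subseteq> W (J \<inter> K)"
proof -
  have mono: "W I \<subseteq> W I'" if "I \<subseteq> I'" for I I'
    unfolding W_def by (intro words_mono image_mono that)
  have mono': "g \<in> W I'" if "g \<in> W I" "I \<subseteq> I'" for g I I'
    using mono that by blast
  have grp: "perm_subgroup (W I)" if "I \<subseteq> {..<r}" for I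
    unfolding W_def using that invol by (intro perm_subgroup_words) auto
  have grp': "perm_subgroup (W {m<..<r})" for m
    by (rule grp) auto
  have split: "\<exists>x\<in>W (I \<inter> {..<m}). \<exists>y\<in>W (I \<inter> {m<..}). g = x \<circ> y"
    if "m \<notin> I" "I \<subseteq> {..<r}" "g \<in> W I" for m I g
  proof -
    have "I = (I \<inter> {..<m}) \<union> (I \<inter> {m<..})" using that(1) by (auto simp: not_less le_less)
    then have "g \<in> words (rho ` (I \<inter> {..<m}) \<union> rho ` (I \<inter> {m<..}))"
      using that(3) unfolding W_def by (metis image_Un)
    then show ?thesis unfolding W_def
      by (rule words_Un[rotated]) (use that(2) in \<open>auto intro!: comm\<close>)
  qed
  \<comment> \<open>For the parts below and above \<open>m\<close>, the wedge hypothesis yields the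
    empty interval \<open>{Suc m..<m}\<close>, so they meet trivially and the factorisation is
    unique.\<close>
  have unique: "x = x' \<and> y = y'"
    if "x \<in> W {..<m}" "x' \<in> W {..<m}" "y \<in> W {m<..<r}" "y' \<in> W {m<..<r}" "x \<circ> y = x' \<circ> y'" "m < r"
    for x x' y y' m
  proof -
    have g1: "perm_subgroup (W {..<m})" and g2: "perm_subgroup (W {m<..<r})"
      using that(6) by (auto intro!: grp)
    have b: "bij x'" "bij y" "bij x" "bij y'" using perm_subgroupD(3) g1 g2 that by metis+
    have "inv' x' \<circ> x \<circ> (y \<circ> inv' y) = (inv' x' \<circ> x') \<circ> y' \<circ> inv' y" using that(5) by (metis comp_assoc)
    then have eq: "inv' x' \<circ> x = y' \<circ> inv' y"
      using b by (simp add: bij_comp_inv)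
    have "inv' x' \<circ> x \<in> W {..<m}" using that g1 perm_subgroupD by metis
    moreover have "y' \<circ> inv' y \<in> W {m<..<r}" using that g2 perm_subgroupD by metis
    moreover have "{m<..<r} = {Suc m..<r}" by auto
    ultimately have "inv' x' \<circ> x \<in> W {Suc m..<m}" using wedge[of "Suc m" m] eq that(6) by auto
    then have "inv' x' \<circ> x = id" by (simp add: W_def words_empty)
    then have "x = x'" "y' \<circ> inv' y = id" using eq b
      by (metis bij_comp_inv comp_assoc comp_id id_comp, metis)
    then show ?thesis using b
      by (metis bij_comp_inv comp_assoc comp_id id_comp)
  qed
  have main: "g \<in> W (J \<inter> K)"
    if IH: "\<And>a' b' J K. b' - a' < b - a \<Longrightarrow> J \<subseteq> {a'..<b'} \<Longrightarrow> K \<subseteq> {a'..<b'} \<Longrightarrow> b' \<le> r \<Longrightarrow> W J \<inter> W K \<subseteq> W (J \<inter> K)"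
      and J: "J \<subseteq> {a..<b}" and K: "K \<subseteq> {a..<b}" and b: "b \<le> r"
      and m: "m \<in> {a..<b}" "m \<notin> J" and l: "l \<in> {a..<b}" "l \<notin> K" and ml: "m \<le> l"
      and gJ: "g \<in> W J" and gK: "g \<in> W K" for a b J K m l g
  proof -
    have Jr: "J \<subseteq> {..<r}" and Kr: "K \<subseteq> {..<r}" and mr: "m < r" and lr: "l < r"
      using J K b m l by auto
    obtain g1 g2 where g12: "g1 \<in> W (J \<inter> {..<m})" "g2 \<in> W (J \<inter> {m<..})" "g = g1 \<circ> g2"
      using split[OF m(2) Jr gJ] by blast
    obtain h1 h2 where h12: "h1 \<in> W (K \<inter> {..<l})" "h2 \<in> W (K \<inter> {l<..})" "g = h1 \<circ> h2"
      using split[OF l(2) Kr gK] by blast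
    have g1m: "g1 \<in> W {..<m}" and g2m: "g2 \<in> W {m<..<r}"
      by (rule mono'[OF g12(1)], simp) (rule mono'[OF g12(2)], use Jr in auto)
    have h1l: "h1 \<in> W {..<l}" and h2l: "h2 \<in> W {l<..<r}"
      by (rule mono'[OF h12(1)], simp) (rule mono'[OF h12(2)], use Kr in auto)
    have IH': "x \<in> W (A \<inter> B)"
      if "x \<in> W A" "x \<in> W B" "b' - a' < b - a" "A \<subseteq> {a'..<b'}" "B \<subseteq> {a'..<b'}" "b' \<le> r"
      for x A B a' b'
      using IH[OF that(3-6)] that(1,2) by blast
    show ?thesis
    proof (cases "m = l")
      case True
      then have eq: "g1 = h1" "g2 = h2"
        using unique[OF g1m _ g2m, of h1 h2] h1l h2l g12(3) h12(3) mr by auto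
      have "g1 \<in> W ((J \<inter> {..<m}) \<inter> (K \<inter> {..<m}))"
        by (rule IH'[of _ _ _ m a]) (use g12(1) h12(1) eq True J K m b in auto)
      then have 1: "g1 \<in> W (J \<inter> K)" by (rule mono') auto
      have "g2 \<in> W ((J \<inter> {m<..}) \<inter> (K \<inter> {m<..}))"
        by (rule IH'[of _ _ _ b "Suc m"]) (use g12(2) h12(2) eq True J K m b in auto)
      then have 2: "g2 \<in> W (J \<inter> K)" by (rule mono') auto
      show ?thesis using 1 2 g12(3) unfolding W_def by (auto intro: words_comp)
    next
      case False
      then have ml: "m < l" using ml by simp
      \<comment> \<open>The overlap of the two factorisations: \<open>c\<close> equals both
        \<open>inv' g1 \<circ> h1\<close> and \<open>g2 \<circ> inv' h2\<close>, hence uses only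
        labels strictly between \<open>m\<close> and \<open>l\<close>, and
        \<open>g = g1 \<circ> c \<circ> h2\<close>.\<close>
      define c where "c = inv' g1 \<circ> h1"
      have bij: "bij g1" "bij h2"
        using perm_subgroupD(3)[OF grp g1m] perm_subgroupD(3)[OF grp' h2l] mr by auto
      have h1: "h1 = g1 \<circ> c" using bij unfolding c_def
        by (simp add: comp_assoc[symmetric] bij_comp_inv)
      have g2: "g2 = c \<circ> h2" using bij g12(3) h12(3) unfolding c_def
        by (metis bij_comp_inv comp_assoc id_comp)
      have c2: "c = g2 \<circ> inv' h2" using bij unfolding g2
        by (simp add: comp_assoc bij_comp_inv)
      have "g1 \<in> W {..<l}" by (rule mono'[OF g1m]) (use ml in auto)
      then have "c \<in> W {..<l}" unfolding c_def
        using h1l lr by (intro perm_subgroupD(2)[OF grp] perm_subgroupD(4)[OF grp]) auto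
      moreover have "h2 \<in> W {m<..<r}" by (rule mono'[OF h2l]) (use ml in auto)
      then have "c \<in> W {m<..<r}" unfolding c2
        using g2m by (intro perm_subgroupD(2)[OF grp'] perm_subgroupD(4)[OF grp']) auto
      moreover have "{m<..<r} = {Suc m..<r}" by auto
      ultimately have c: "c \<in> W {Suc m..<l}" using wedge[of "Suc m" l] mr lr by auto
      have cm: "c \<in> W {m<..<r}" by (rule mono'[OF c]) (use lr in auto)
      have cl: "c \<in> W {..<l}" by (rule mono'[OF c]) auto
      \<comment> \<open>Since \<open>h1 = g1 \<circ> c\<close>, it has one description through
        \<open>J\<close> and one through \<open>K\<close>, both inside \<open>{a..<l}\<close>. After
        the induction hypothesis, splitting at \<open>m\<close> recovers \<open>g1\<close> and
        \<open>c\<close> by uniqueness, now with labels in \<open>K\<close>. The step for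
        \<open>g2\<close> below is the mirror image and puts the labels of \<open>c\<close> into
        \<open>J\<close>.\<close>
      have "h1 \<in> W (((J \<inter> {..<m}) \<union> {Suc m..<l}) \<inter> (K \<inter> {..<l}))"
      proof -
        have "g1 \<in> W ((J \<inter> {..<m}) \<union> {Suc m..<l})" by (intro mono'[OF g12(1)]) auto
        moreover have "c \<in> W ((J \<inter> {..<m}) \<union> {Suc m..<l})" by (intro mono'[OF c]) auto
        ultimately have "h1 \<in> W ((J \<inter> {..<m}) \<union> {Suc m..<l})"
          unfolding h1 W_def by (rule words_comp)
        moreover have "(J \<inter> {..<m}) \<union> {Suc m..<l} \<subseteq> {a..<l}" "K \<inter> {..<l} \<subseteq> {a..<l}"
          using J K m l ml by auto
        ultimately show ?thesis using h12(1) l m b by - (rule IH'[of _ _ _ l a], assumption+, auto)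
      qed
      then obtain u v where uv: "u \<in> W (((J \<inter> {..<m}) \<union> {Suc m..<l}) \<inter> (K \<inter> {..<l}) \<inter> {..<m})"
          "v \<in> W (((J \<inter> {..<m}) \<union> {Suc m..<l}) \<inter> (K \<inter> {..<l}) \<inter> {m<..})" "h1 = u \<circ> v"
        using split[of m "((J \<inter> {..<m}) \<union> {Suc m..<l}) \<inter> (K \<inter> {..<l})" h1] m(2) Kr by auto
      have "u \<in> W {..<m}" "v \<in> W {m<..<r}"
        by (rule mono'[OF uv(1)], simp) (rule mono'[OF uv(2)], use Kr in auto)
      then have uv': "u = g1" "v = c" using unique[OF _ g1m _ cm, of u v] uv(3) h1 mr by auto
      have g1: "g1 \<in> W (J \<inter> K)"
        unfolding uv'(1)[symmetric] by (rule mono'[OF uv(1)]) auto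
      have cK: "c \<in> W (K \<inter> {Suc m..<l})"
        unfolding uv'(2)[symmetric] by (rule mono'[OF uv(2)]) auto
      have "g2 \<in> W ((J \<inter> {m<..}) \<inter> ({Suc m..<l} \<union> (K \<inter> {l<..})))"
      proof -
        have "h2 \<in> W ({Suc m..<l} \<union> (K \<inter> {l<..}))" by (intro mono'[OF h12(2)]) auto
        moreover have "c \<in> W ({Suc m..<l} \<union> (K \<inter> {l<..}))" by (intro mono'[OF c]) auto
        ultimately have "g2 \<in> W ({Suc m..<l} \<union> (K \<inter> {l<..}))"
          unfolding g2 W_def by (intro words_comp)
        moreover have "{Suc m..<l} \<union> (K \<inter> {l<..}) \<subseteq> {Suc m..<b}" "J \<inter> {m<..} \<subseteq> {Suc m..<b}"
          using J K m l ml by auto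
        ultimately show ?thesis using g12(2) m b by - (rule IH'[of _ _ _ b "Suc m"], assumption+, auto)
      qed
      then obtain u v where uv: "u \<in> W ((J \<inter> {m<..}) \<inter> ({Suc m..<l} \<union> (K \<inter> {l<..})) \<inter> {..<l})"
          "v \<in> W ((J \<inter> {m<..}) \<inter> ({Suc m..<l} \<union> (K \<inter> {l<..})) \<inter> {l<..})" "g2 = u \<circ> v"
        using split[of l "(J \<inter> {m<..}) \<inter> ({Suc m..<l} \<union> (K \<inter> {l<..}))" g2] l(2) Jr by auto
      have "u \<in> W {..<l}" "v \<in> W {l<..<r}"
        by (rule mono'[OF uv(1)], simp) (rule mono'[OF uv(2)], use Jr in auto)
      then have uv': "u = c" "v = h2" using unique[OF _ cl _ h2l, of u v] uv(3) g2 lr by auto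
      have h2: "h2 \<in> W (J \<inter> K)"
        unfolding uv'(2)[symmetric] by (rule mono'[OF uv(2)]) auto
      have cJ: "c \<in> W (J \<inter> {Suc m..<l})"
        unfolding uv'(1)[symmetric] by (rule mono'[OF uv(1)]) auto
      have "c \<in> W ((J \<inter> {Suc m..<l}) \<inter> (K \<inter> {Suc m..<l}))"
        by (rule IH'[of _ _ _ l "Suc m"]) (use cJ cK m l ml b in auto)
      then have "c \<in> W (J \<inter> K)" by (rule mono') auto
      then show ?thesis using g1 h2 unfolding g12(3) g2 W_def by (intro words_comp)
    qed
  qed
  show ?thesis using assms(5-7)
  proof (induction "b - a" arbitrary: a b J K rule: less_induct)
    case less
    consider "J = {a..<b}" | "K = {a..<b}" | m l where "m \<in> {a..<b}" "m \<notin> J" "l \<in> {a..<b}" "l \<notin> K"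
      using less.prems by blast
    then show ?case
    proof cases
      case 1
      then show ?thesis using less.prems by (metis Int_absorb1 Int_lower2)
    next
      case 2
      then show ?thesis using less.prems by (metis Int_absorb2 Int_lower1)
    next
      case 3
      show ?thesis
      proof
        fix g assume g: "g \<in> W J \<inter> W K"
        show "g \<in> W (J \<inter> K)"
        proof (cases "m \<le> l")
          case True
          show ?thesis
            by (rule main[of b a J K m l g]) (use less 3 True g in auto)
        next
          case False
          have "g \<in> W (K \<inter> J)"
            by (rule main[of b a K J l m g]) (use less 3 False g in auto)
          then show ?thesis by (simp add: Int_commute)
        qed
      qed
    qed
  qed
qed

section \<open>Generating even permutations\<close>

text \<open>For an involution \<open>u\<close> this is an equivalence relation, whether or not \<open>u\<close> is disjoint
  from the transpositions involved.\<close>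

definition linked :: "('a \<Rightarrow> 'a) set \<Rightarrow> ('a \<Rightarrow> 'a) \<Rightarrow> 'a \<Rightarrow> 'a \<Rightarrow> bool" where
  "linked H u x y \<longleftrightarrow> x = y \<or> transpose x y \<circ> u \<in> H"

lemma linked_refl [simp]: "linked H u x x"
  by (simp add: linked_def)

lemma linked_sym: "linked H u x y \<Longrightarrow> linked H u y x"
  by (auto simp: linked_def transpose_commute)

text \<open>The middle factor enters as its inverse \<open>u \<circ> transpose y z\<close>, so that
  two copies of \<open>u\<close> meet and cancel; the three transpositions then form a conjugate,
  and one \<open>u\<close> is left at the end.\<close>

lemma linked_trans:
  assumes H: "perm_subgroup H" and u: "u \<circ> u = id" and xy: "linked H u x y" and yz: "linked H u y z"
  shows "linked H u x z"
proof (cases "x = y \<or> y = z \<or> x = z")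
  case True
  then show ?thesis using xy yz by auto
next
  case False
  then have 1: "transpose x y \<circ> u \<in> H" "transpose y z \<circ> u \<in> H" using xy yz by (auto simp: linked_def)
  have ui: "inv' u = u" by (rule inv_unique_comp[OF u u])
  have ub: "bij u" by (rule o_bij[OF u u])
  have "inv' (transpose y z \<circ> u) = u \<circ> transpose y z"
    by (simp add: o_inv_distrib ub ui)
  then have "u \<circ> transpose y z \<in> H" using perm_subgroupD(4)[OF H 1(2)] by simp
  then have "(transpose x y \<circ> u) \<circ> (u \<circ> transpose y z) \<circ> (transpose x y \<circ> u) \<in> H"
    using 1 perm_subgroupD(2)[OF H] by blast
  moreover have "(transpose x y \<circ> u) \<circ> (u \<circ> transpose y z) \<circ> (transpose x y \<circ> u)
      = transpose x y \<circ> (u \<circ> u) \<circ> transpose y z \<circ> transpose x y \<circ> u"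
    by (simp add: comp_assoc)
  moreover have "transpose x y \<circ> transpose y z \<circ> transpose x y = transpose x z"
    using False by (auto simp: fun_eq_iff transpose_def)
  ultimately show ?thesis by (simp add: linked_def u)
qed

lemma conj_transpose:
  assumes "h \<circ> h = id"
  shows "h \<circ> transpose x y \<circ> h = transpose (h x) (h y)"
proof -
  have hh: "h (h v) = v" for v using assms by (simp add: fun_eq_iff)
  show ?thesis
  proof
    fix v
    have "h v = x \<longleftrightarrow> v = h x" "h v = y \<longleftrightarrow> v = h y" using hh by metis+
    then show "(h \<circ> transpose x y \<circ> h) v = transpose (h x) (h y) v"
      by (simp add: transpose_def hh)
  qed
qed

text \<open>Conjugation moves \<open>u\<close> as well. If \<open>h\<close> does not commute with
  \<open>u\<close> the result is no link but a mixed product; \<open>link_P\<close> exploits exactly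
  this with label 1.\<close>

lemma conj_linked:
  assumes H: "perm_subgroup H" and u: "u \<circ> u = id" and h: "h \<in> H" "h \<circ> h = id"
    and "linked H u x y" "x \<noteq> y"
  shows "transpose (h x) (h y) \<circ> (h \<circ> u \<circ> h) \<in> H"
proof -
  have "h \<circ> (transpose x y \<circ> u) \<circ> h \<in> H"
    using assms perm_subgroupD(2)[OF H] by (auto simp: linked_def)
  moreover have "h \<circ> (transpose x y \<circ> u) \<circ> h = (h \<circ> transpose x y \<circ> h) \<circ> (h \<circ> u \<circ> h)"
    using h(2) by (metis comp_assoc comp_id)
  ultimately show ?thesis by (simp add: conj_transpose h(2))
qed

lemma linked_image:
  assumes H: "perm_subgroup H" and u: "u \<circ> u = id" and h: "h \<in> H" "h \<circ> h = id" "h \<circ> u = u \<circ> h"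
    and l: "linked H u x y" and eq: "h x = x'" "h y = y'"
  shows "linked H u x' y'"
proof (cases "x = y")
  case False
  have "h \<circ> u \<circ> h = u" using h by (metis comp_assoc comp_id)
  then show ?thesis using conj_linked[OF H u h(1,2) l False] eq by (simp add: linked_def)
qed (use eq in auto)

text \<open>Induction on the number of moved points: composing with the transposition that
  sends \<open>g x\<close> back to \<open>x\<close> fixes \<open>x\<close> and changes the parity.\<close>

lemma linked_generates:
  assumes H: "perm_subgroup H" and u: "u \<circ> u = id"
  shows "permutation g \<Longrightarrow> (\<And>x. linked H u x (g x)) \<Longrightarrow> (if evenperm g then g \<in> H else u \<circ> g \<in> H)"
proof (induction "card {x. g x \<noteq> x}" arbitrary: g rule: less_induct)
  case less
  show ?case
  proof (cases "\<exists>x. g x \<noteq> x")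
    case False
    then have "g = id" by (simp add: fun_eq_iff)
    then show ?thesis by (simp add: perm_subgroupD(1)[OF H])
  next
    case True
    then obtain x where x: "g x \<noteq> x" by blast
    have inj: "g a = g b \<longleftrightarrow> a = b" for a b
      using permutation_bijective[OF less.prems(1)] by (meson bij_is_inj inj_eq)
    define t where "t = transpose x (g x)"
    have tt: "t \<circ> t = id" by (simp add: t_def)
    have pt: "permutation t" by (simp add: t_def permutation_swap_id)
    have ev: "evenperm (t \<circ> g) \<longleftrightarrow> \<not> evenperm g"
      using evenperm_comp[OF pt less.prems(1)] x by (simp add: t_def evenperm_swap)
    have "{y. (t \<circ> g) y \<noteq> y} \<subset> {y. g y \<noteq> y}"
    proof
      show "{y. (t \<circ> g) y \<noteq> y} \<subseteq> {y. g y \<noteq> y}"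
        using x inj by (auto simp: t_def transpose_def)
      have "(t \<circ> g) x = x" by (simp add: t_def)
      then show "{y. (t \<circ> g) y \<noteq> y} \<noteq> {y. g y \<noteq> y}" using x by blast
    qed
    then have "card {y. (t \<circ> g) y \<noteq> y} < card {y. g y \<noteq> y}"
      using permutation_finite_support[OF less.prems(1)] psubset_card_mono by blast
    moreover have "permutation (t \<circ> g)" using pt less.prems(1) by (rule permutation_compose)
    moreover have "linked H u y ((t \<circ> g) y)" for y
      using less.prems(2)[of y] less.prems(2)[of x] linked_sym[OF less.prems(2)[of x]]
        linked_trans[OF H u, of y "g x" x] linked_trans[OF H u, of y x "g x"]
      by (auto simp: t_def transpose_def)
    ultimately have IH: "if evenperm (t \<circ> g) then t \<circ> g \<in> H else u \<circ> (t \<circ> g) \<in> H"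
      using less.hyps[of "t \<circ> g"] by blast
    \<comment> \<open>Both \<open>t \<circ> u\<close> and its inverse \<open>u \<circ> t\<close> lie
      in \<open>H\<close>; the parity of \<open>g\<close> decides which of them restores the removed
      transposition.\<close>
    have tu: "t \<circ> u \<in> H" using less.prems(2)[of x] x by (simp add: linked_def t_def)
    have ui: "inv' u = u" by (rule inv_unique_comp[OF u u])
    have ub: "bij u" by (rule o_bij[OF u u])
    have "inv' (t \<circ> u) = u \<circ> t"
      using ub ui by (simp add: o_inv_distrib t_def)
    then have ut: "u \<circ> t \<in> H" using perm_subgroupD(4)[OF H tu] by simp
    show ?thesis
    proof (cases "evenperm g")
      case True
      then have "u \<circ> (t \<circ> g) \<in> H" using IH ev by simp
      then have "(t \<circ> u) \<circ> (u \<circ> (t \<circ> g)) \<in> H" using tu perm_subgroupD(2)[OF H] by blast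
      moreover have "(t \<circ> u) \<circ> (u \<circ> (t \<circ> g)) = g"
        using u tt by (metis comp_assoc comp_id id_comp)
      ultimately show ?thesis using True by simp
    next
      case False
      then have "t \<circ> g \<in> H" using IH ev by simp
      then have "(u \<circ> t) \<circ> (t \<circ> g) \<in> H" using ut perm_subgroupD(2)[OF H] by blast
      moreover have "(u \<circ> t) \<circ> (t \<circ> g) = u \<circ> g"
        using tt by (metis comp_assoc comp_id id_comp)
      ultimately show ?thesis using False by simp
    qed
  qed
qed

section \<open>Index permutations and signed permutations of the two chains\<close>

definition lift :: "(nat \<Rightarrow> nat) \<Rightarrow> vtx \<Rightarrow> vtx" where
  "lift p v = (case v of P i \<Rightarrow> P i | Y j \<Rightarrow> Y (p j) | Z j \<Rightarrow> Z (p j))"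

lemma lift_simps [simp]: "lift p (P i) = P i" "lift p (Y j) = Y (p j)" "lift p (Z j) = Z (p j)"
  by (simp_all add: lift_def)

lemma lift_comp: "lift (p \<circ> q) = lift p \<circ> lift q"
  by (rule ext) (simp add: lift_def split: vtx.split)

lemma lift_id: "lift id = id"
  by (rule ext) (simp add: lift_def split: vtx.split)

lemma lift_inv: "bij p \<Longrightarrow> inv' (lift p) = lift (inv' p)"
  by (rule inv_unique_comp)
    (simp_all add: lift_comp[symmetric] lift_id bij_comp_inv)

lemma lift_bij: "bij p \<Longrightarrow> bij (lift p)"
  by (rule o_bij[of "lift (inv' p)"])
    (simp_all add: lift_comp[symmetric] lift_id bij_comp_inv)

text \<open>\<open>linked_generates\<close> is applied with \<open>u = id\<close> to the preimage of
  \<open>H\<close> under \<open>lift\<close>. Links are then genuine transpositions of indices, so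
  odd index permutations are reached too.\<close>

lemma lift_in:
  assumes H: "perm_subgroup H"
    and adj: "\<And>k. a \<le> k \<Longrightarrow> k < c \<Longrightarrow> lift (transpose k (Suc k)) \<in> H"
    and p: "p permutes {a..c}"
  shows "lift p \<in> H"
proof -
  define H' where "H' = {p. bij p \<and> lift p \<in> H}"
  have H': "perm_subgroup H'"
    using H by (auto simp: perm_subgroup_def H'_def lift_id lift_comp bij_comp lift_inv[symmetric] bij_imp_bij_inv)
  have link: "a \<le> k \<Longrightarrow> k \<le> l \<Longrightarrow> l \<le> c \<Longrightarrow> linked H' id k l" for k l
  proof (induction l)
    case (Suc l)
    show ?case
    proof (cases "k = Suc l")
      case False
      have "linked H' id l (Suc l)" using adj[of l] Suc False by (simp add: linked_def H'_def)
      moreover have "linked H' id k l" by (intro Suc.IH) (use Suc.prems False in auto)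
      ultimately show ?thesis using linked_trans[OF H' comp_id] by blast
    qed simp
  qed simp
  have "linked H' id k (p k)" for k
  proof (cases "k \<in> {a..c}")
    case True
    then have "p k \<in> {a..c}" using permutes_in_image[OF p] by blast
    then show ?thesis using link[of k "p k"] link[of "p k" k] True linked_sym
      by (metis atLeastAtMost_iff linear)
  next
    case False
    then show ?thesis using p by (simp add: permutes_not_in)
  qed
  then have "p \<in> H'"
    using linked_generates[OF H', of id p] permutes_imp_permutation[OF _ p] by (auto split: if_splits)
  then show ?thesis by (simp add: H'_def)
qed

text \<open>Total on \<open>vtx\<close>, so it also exchanges the vertex \<open>Y 2\<close> with the
  non-vertex \<open>Z 2\<close>. It serves as a commutation test for labels from 3 on, and these fix
  both points.\<close>

definition flip :: "vtx \<Rightarrow> vtx" where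
  "flip v = (case v of P i \<Rightarrow> P i | Y j \<Rightarrow> Z j | Z j \<Rightarrow> Y j)"

lemma flip_simps [simp]: "flip (P i) = P i" "flip (Y j) = Z j" "flip (Z j) = Y j"
  by (simp_all add: flip_def)

lemma flip_flip [simp]: "flip (flip v) = v"
  by (cases v) auto

text \<open>Such a \<open>g\<close> is an element of the hyperoctahedral group on the blocks
  \<open>{Y k, Z k}\<close>, and \<open>p\<close> is its action on the blocks. If
  \<open>p k = p l\<close>, then \<open>g (Y k)\<close> is the image of \<open>Y l\<close> or of
  \<open>Z l\<close>, so injectivity of \<open>g\<close> gives \<open>k = l\<close>.\<close>

lemma signed_decomposition:
  assumes g: "bij g" and comm: "\<And>v. g (flip v) = flip (g v)" and P: "\<And>i. g (P i) = P i"
    and out: "\<And>k. k \<notin> {a..c} \<Longrightarrow> g (Y k) = Y k"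
  shows "\<exists>p. p permutes {a..c} \<and> (\<forall>k. g (Y k) = Y (p k) \<or> g (Y k) = Z (p k))"
proof -
  define idx where "idx v = (case v of P i \<Rightarrow> i | Y j \<Rightarrow> j | Z j \<Rightarrow> j)" for v
  define p where "p k = idx (g (Y k))" for k
  have inj: "g v = g w \<longleftrightarrow> v = w" for v w using g by (meson bij_is_inj inj_eq)
  have YZ: "g (Y k) = Y (p k) \<or> g (Y k) = Z (p k)" for k
  proof (cases "g (Y k)")
    case (P i)
    then have "g (Y k) = g (P i)" using assms(3) by simp
    then show ?thesis using inj by simp
  qed (auto simp: p_def idx_def)
  have comm': "g (Z k) = flip (g (Y k))" for k using comm[of "Y k"] by simp
  have "inj p"
  proof
    fix k l assume "p k = p l"
    then have "g (Y k) = g (Y l) \<or> g (Y k) = g (Z l)"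
      using YZ[of k] YZ[of l] comm'[of l] by auto
    then show "k = l" by (simp add: inj)
  qed
  moreover have out': "p k = k" if "k \<notin> {a..c}" for k using out[OF that] by (simp add: p_def idx_def)
  moreover have "\<exists>k. p k = j" for j
  proof -
    obtain v where v: "g v = Y j" using g by (metis bij_pointE)
    show ?thesis
    proof (cases v)
      case (P i)
      then show ?thesis using v assms(3) by simp
    next
      case (Y k)
      then show ?thesis using v YZ[of k] by auto
    next
      case (Z k)
      then show ?thesis using v YZ[of k] comm'[of k] by auto
    qed
  qed
  ultimately have "p permutes {a..c}" unfolding permutes_def by (metis injD)
  then show ?thesis using YZ by blast
qed

section \<open>The generators of the labelled graph\<close>

text \<open>The extra swap is the last edge of each chain, between indices r = q + 8 and r + 1,
  which carries label r - 2 = q + 6.\<close>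

definition step :: "nat \<Rightarrow> nat \<Rightarrow> nat \<Rightarrow> nat" where
  "step q k j = (if j = k then Suc k else if j = Suc k then k
     else if k = q + 6 \<and> j = q + 8 then q + 9 else if k = q + 6 \<and> j = q + 9 then q + 8 else j)"

text \<open>Closed form of \<open>label_perm (edges49 (q + 8)) k\<close>, justified by
  \<open>label_perm_edges\<close>; it replaces the definite description by a computation. The
  clauses with q + 4 = r - 4 are the rungs.\<close>

fun rho :: "nat \<Rightarrow> nat \<Rightarrow> vtx \<Rightarrow> vtx" where
  "rho q k (P i) =
     (if k = 0 then (if i = 1 then P 2 else if i = 2 then P 1 else if i = 3 then P 4 else if i = 4 then P 3 else P i)
      else if k = 1 then (if i = 2 then P 3 else if i = 3 then P 2 else if i = 4 then Y 2 else P i)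
      else if k = 2 then (if i = 3 then P 4 else if i = 4 then P 3 else P i)
      else P i)"
| "rho q k (Y j) =
     (if k = 1 \<and> j = 2 then P 4
      else if k = 2 then (if j = 2 then Y 3 else if j = 3 then Y 2 else Y j)
      else if k = q + 4 \<and> q + 6 \<le> j \<and> j \<le> q + 9 then Z j
      else if 3 \<le> k \<and> k \<le> q + 7 then Y (step q k j) else Y j)"
| "rho q k (Z j) =
     (if k = q + 4 \<and> q + 6 \<le> j \<and> j \<le> q + 9 then Y j
      else if 3 \<le> k \<and> k \<le> q + 7 then Z (step q k j) else Z j)"

declare rho.simps [simp del]

lemma rho_rho [simp]: "rho q k (rho q k v) = v"
  by (cases v) (auto simp: rho.simps step_def)

lemma rho_invol: "rho q k \<circ> rho q k = id"
  by (simp add: fun_eq_iff)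

lemma rho_ge3:
  assumes "3 \<le> k" "k \<le> q + 7"
  shows "rho q k (P i) = P i"
    "rho q k (Y j) = (if k = q + 4 \<and> q + 6 \<le> j \<and> j \<le> q + 9 then Z j else Y (step q k j))"
    "rho q k (Z j) = (if k = q + 4 \<and> q + 6 \<le> j \<and> j \<le> q + 9 then Y j else Z (step q k j))"
  using assms by (auto simp: rho.simps)

lemma rho_flip: "3 \<le> k \<Longrightarrow> k \<le> q + 7 \<Longrightarrow> rho q k (flip v) = flip (rho q k v)"
  by (cases v) (auto simp: rho_ge3)

lemma rho_commute_point:
  assumes "i + 2 \<le> j" "j < q + 8"
  shows "rho q i (rho q j v) = rho q j (rho q i v)"
proof (cases "3 \<le> i")
  case True
  then have i: "3 \<le> i" "i \<le> q + 7" and j: "3 \<le> j" "j \<le> q + 7" using assms by auto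
  show ?thesis
  proof (cases v)
    case (P k)
    then show ?thesis by (simp add: rho_ge3 i j)
  next
    case (Y k)
    then show ?thesis using assms by (auto simp add: rho_ge3 i j step_def)
  next
    case (Z k)
    then show ?thesis using assms by (auto simp add: rho_ge3 i j step_def)
  qed
next
  case False
  then consider "i = 0" | "i = 1" | "i = 2" by linarith
  then show ?thesis
  proof cases
    case 1
    then show ?thesis using assms by (cases v) (auto simp: rho.simps step_def)
  next
    case 2
    then show ?thesis using assms by (cases v) (auto simp: rho.simps step_def)
  next
    case 3
    then show ?thesis using assms by (cases v) (auto simp: rho.simps step_def)
  qed
qed

lemma rho_commute: "i + 2 \<le> j \<Longrightarrow> j < q + 8 \<Longrightarrow> rho q i \<circ> rho q j = rho q j \<circ> rho q i"
  unfolding fun_eq_iff o_apply by (blast intro: rho_commute_point)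

lemma rho_outside: "v \<notin> verts49 (q + 8) \<Longrightarrow> rho q k v = v"
  by (cases v) (auto simp: verts49_def rho.simps step_def image_iff)

lemma rho_permutes: "rho q k permutes verts49 (q + 8)"
  unfolding permutes_def using rho_outside by (metis rho_rho)

lemma finite_verts [simp]: "finite (verts49 r)"
  by (simp add: verts49_def)

lemma even_two_transposes: "a \<noteq> b \<Longrightarrow> c \<noteq> d \<Longrightarrow> evenperm (transpose a b \<circ> transpose c d)"
  by (simp add: evenperm_comp permutation_swap_id evenperm_swap)

lemma even_comp: "permutation p \<Longrightarrow> permutation q \<Longrightarrow> evenperm p \<Longrightarrow> evenperm q \<Longrightarrow> evenperm (p \<circ> q)"
  by (simp add: evenperm_comp)

text \<open>Each label occurs on two, four (q + 6) or six (q + 4) edges.\<close>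

lemma rho_even:
  assumes "k < q + 8"
  shows "evenperm (rho q k)"
proof -
  define D where "D = (\<lambda>a b c d :: vtx. transpose a b \<circ> transpose c d)"
  have perm: "permutation (D a b c d)" for a b c d
    by (simp add: D_def permutation_swap_id permutation_compose)
  have even: "a \<noteq> b \<Longrightarrow> c \<noteq> d \<Longrightarrow> evenperm (D a b c d)" for a b c d
    by (simp add: D_def even_two_transposes)
  consider "k = 0" | "k = 1" | "k = 2" | "3 \<le> k" "k \<noteq> q + 4" "k \<noteq> q + 6" | "k = q + 4" | "k = q + 6"
    by linarith
  then show ?thesis
  proof cases
    case 1
    have "rho q k = D (P 1) (P 2) (P 3) (P 4)"
    proof
      fix v show "rho q k v = D (P 1) (P 2) (P 3) (P 4) v"
        using 1 by (cases v) (auto simp: rho.simps D_def transpose_def)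
    qed
    then show ?thesis using even by simp
  next
    case 2
    have "rho q k = D (P 2) (P 3) (P 4) (Y 2)"
    proof
      fix v show "rho q k v = D (P 2) (P 3) (P 4) (Y 2) v"
        using 2 by (cases v) (auto simp: rho.simps D_def transpose_def)
    qed
    then show ?thesis using even by simp
  next
    case 3
    have "rho q k = D (P 3) (P 4) (Y 2) (Y 3)"
    proof
      fix v show "rho q k v = D (P 3) (P 4) (Y 2) (Y 3) v"
        using 3 by (cases v) (auto simp: rho.simps D_def transpose_def)
    qed
    then show ?thesis using even by simp
  next
    case 4
    have "rho q k = D (Y k) (Y (Suc k)) (Z k) (Z (Suc k))"
    proof
      fix v show "rho q k v = D (Y k) (Y (Suc k)) (Z k) (Z (Suc k)) v"
        using 4 assms by (cases v) (auto simp: rho_ge3 step_def D_def transpose_def)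
    qed
    then show ?thesis using even by simp
  next
    case 5
    have "rho q k = D (Y k) (Y (Suc k)) (Z k) (Z (Suc k))
      \<circ> (D (Y (q+6)) (Z (q+6)) (Y (q+7)) (Z (q+7)) \<circ> D (Y (q+8)) (Z (q+8)) (Y (q+9)) (Z (q+9)))" (is "_ = ?R")
    proof
      fix v show "rho q k v = ?R v"
      proof (cases v)
        case (P i) then show ?thesis using 5 by (simp add: rho_ge3 D_def transpose_def)
      next
        case (Y i)
        consider "i < q + 6" | "i = q + 6" | "i = q + 7" | "i = q + 8" | "i = q + 9" | "q + 9 < i" by linarith
        then show ?thesis using 5 Y by cases (auto simp: rho_ge3 step_def D_def transpose_def)
      next
        case (Z i)
        consider "i < q + 6" | "i = q + 6" | "i = q + 7" | "i = q + 8" | "i = q + 9" | "q + 9 < i" by linarith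
        then show ?thesis using 5 Z by cases (auto simp: rho_ge3 step_def D_def transpose_def)
      qed
    qed
    then show ?thesis by (simp add: even perm even_comp permutation_compose)
  next
    case 6
    have "rho q k = D (Y k) (Y (Suc k)) (Z k) (Z (Suc k))
      \<circ> D (Y (q+8)) (Y (q+9)) (Z (q+8)) (Z (q+9))" (is "_ = ?R")
    proof
      fix v show "rho q k v = ?R v"
        using 6 by (cases v) (auto simp: rho_ge3 step_def D_def transpose_def)
    qed
    then show ?thesis by (simp add: even perm even_comp)
  qed
qed

section \<open>Agreement of the closed form with the labelled graph\<close>

lemma label_perm_eqI:
  assumes "\<And>v w. w \<noteq> v \<Longrightarrow> ({v, w}, k) \<in> E \<longleftrightarrow> w = f v"
  shows "label_perm E k = f"
proof
  fix v
  show "label_perm E k v = f v"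
    using assms by (cases "f v = v") (auto simp: label_perm_def)
qed

lemma edges49_PP:
  assumes "i \<noteq> l"
  shows "({P i, P l}, k) \<in> edges49 (q + 8) \<longleftrightarrow>
    {i, l} = {1, 2} \<and> k = 0 \<or> {i, l} = {2, 3} \<and> k = 1 \<or> {i, l} = {3, 4} \<and> (k = 0 \<or> k = 2)"
  by (auto simp: edges49_def doubleton_eq_iff)

lemma edges49_PY: "({P i, Y l}, k) \<in> edges49 (q + 8) \<longleftrightarrow> i = 4 \<and> l = 2 \<and> k = 1"
  by (auto simp: edges49_def doubleton_eq_iff)

lemma edges49_PZ: "({P i, Z l}, k) \<notin> edges49 (q + 8)"
  by (auto simp: edges49_def doubleton_eq_iff)

lemma edges49_YY:
  "({Y i, Y l}, k) \<in> edges49 (q + 8) \<longleftrightarrow>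
    (2 \<le> k \<and> k \<le> q + 7 \<and> (i = k \<and> l = Suc k \<or> i = Suc k \<and> l = k)) \<or>
    (k = q + 6 \<and> (i = q + 8 \<and> l = q + 9 \<or> i = q + 9 \<and> l = q + 8))"
  by (simp add: edges49_def doubleton_eq_iff) auto

lemma edges49_ZZ:
  "({Z i, Z l}, k) \<in> edges49 (q + 8) \<longleftrightarrow>
    (3 \<le> k \<and> k \<le> q + 7 \<and> (i = k \<and> l = Suc k \<or> i = Suc k \<and> l = k)) \<or>
    (k = q + 6 \<and> (i = q + 8 \<and> l = q + 9 \<or> i = q + 9 \<and> l = q + 8))"
  by (simp add: edges49_def doubleton_eq_iff) auto

lemma edges49_YZ:
  "({Y i, Z l}, k) \<in> edges49 (q + 8) \<longleftrightarrow> k = q + 4 \<and> i = l \<and> q + 6 \<le> i \<and> i \<le> q + 9"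
proof -
  have "({Y i, Z l}, k) \<in> edges49 (q + 8) \<longleftrightarrow>
    k = q + 4 \<and> i = l \<and> (i = q + 6 \<or> i = q + 7 \<or> i = q + 8 \<or> i = q + 9)"
    by (simp add: edges49_def doubleton_eq_iff) auto
  then show ?thesis by auto
qed

lemma label_perm_edges:
  assumes k: "k < q + 8"
  shows "label_perm (edges49 (q + 8)) k = rho q k"
proof (rule label_perm_eqI)
  fix v w :: vtx
  assume ne: "w \<noteq> v"
  have PY: "({Y l, P i}, k) \<in> edges49 (q + 8) \<longleftrightarrow> i = 4 \<and> l = 2 \<and> k = 1" for i l
    using edges49_PY by (simp add: insert_commute)
  have PZ: "({Z l, P i}, k) \<notin> edges49 (q + 8)" for i l
    using edges49_PZ by (simp add: insert_commute)
  have YZ: "({Z l, Y i}, k) \<in> edges49 (q + 8) \<longleftrightarrow> k = q + 4 \<and> i = l \<and> q + 6 \<le> i \<and> i \<le> q + 9" for i l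
    using edges49_YZ by (simp add: insert_commute)
  show "({v, w}, k) \<in> edges49 (q + 8) \<longleftrightarrow> w = rho q k v"
  proof (cases v)
    case v: (P i)
    show ?thesis
    proof (cases w)
      case w: (P l)
      show ?thesis using ne by (auto simp: v w edges49_PP rho.simps doubleton_eq_iff)
    next
      case w: (Y l)
      show ?thesis by (auto simp: v w edges49_PY rho.simps)
    next
      case w: (Z l)
      show ?thesis by (auto simp: v w edges49_PZ rho.simps)
    qed
  next
    case v: (Y i)
    show ?thesis
    proof (cases w)
      case w: (P l)
      show ?thesis by (auto simp: v w PY rho.simps)
    next
      case w: (Y l)
      show ?thesis
      proof (cases "k = q + 4 \<and> q + 6 \<le> i \<and> i \<le> q + 9")
        case True
        then show ?thesis by (auto simp: v w edges49_YY rho.simps)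
      next
        case False
        then show ?thesis using ne k by (auto simp: v w edges49_YY rho.simps step_def)
      qed
    next
      case w: (Z l)
      show ?thesis by (auto simp: v w edges49_YZ rho.simps)
    qed
  next
    case v: (Z i)
    show ?thesis
    proof (cases w)
      case w: (P l)
      show ?thesis by (auto simp: v w PZ rho.simps)
    next
      case w: (Y l)
      show ?thesis by (auto simp: v w YZ rho.simps)
    next
      case w: (Z l)
      show ?thesis
      proof (cases "k = q + 4 \<and> q + 6 \<le> i \<and> i \<le> q + 9")
        case True
        then show ?thesis by (auto simp: v w edges49_ZZ rho.simps)
      next
        case False
        then show ?thesis using ne k by (auto simp: v w edges49_ZZ rho.simps step_def)
      qed
    qed
  qed
qed

section \<open>Interval subgroups\<close>

definition W :: "nat \<Rightarrow> nat set \<Rightarrow> (vtx \<Rightarrow> vtx) set" where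
  "W q J = words (rho q ` J)"

lemma W_subgroup: "perm_subgroup (W q J)"
  unfolding W_def by (rule perm_subgroup_words) (auto simp: rho_invol)

lemma W_rho: "k \<in> J \<Longrightarrow> rho q k \<in> W q J"
  by (simp add: W_def words_base)

lemma W_mono: "J \<subseteq> K \<Longrightarrow> g \<in> W q J \<Longrightarrow> g \<in> W q K"
  unfolding W_def using words_mono[of "rho q ` J" "rho q ` K"] by (auto simp: image_mono)

lemma W_comp: "g \<in> W q J \<Longrightarrow> h \<in> W q J \<Longrightarrow> g \<circ> h \<in> W q J"
  by (simp add: W_def words_comp)

lemma W_bij: "g \<in> W q J \<Longrightarrow> bij g"
  using perm_subgroupD(3)[OF W_subgroup] .

lemma W_cancel: "e \<in> W q J \<Longrightarrow> e \<circ> g \<in> W q J \<Longrightarrow> g \<in> W q J"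
  using cancel_left[OF W_subgroup] .

lemma W_induct [consumes 1, case_names id step]:
  assumes "g \<in> W q J" and "Q id" and "\<And>k g. k \<in> J \<Longrightarrow> Q g \<Longrightarrow> Q (rho q k \<circ> g)"
  shows "Q g"
  using assms(1) unfolding W_def
proof (induction rule: words.induct)
  case words_id
  show ?case by (rule assms(2))
next
  case (words_step s g)
  then show ?case using assms(3) by blast
qed

lemma W_fix:
  assumes "g \<in> W q J" and "\<And>k. k \<in> J \<Longrightarrow> rho q k v = v"
  shows "g v = v"
  using assms(1) by (induction rule: W_induct) (simp_all add: assms(2))

lemma W_maps:
  assumes "g \<in> W q J" and "\<And>k v. k \<in> J \<Longrightarrow> v \<in> A \<Longrightarrow> rho q k v \<in> A"
  shows "v \<in> A \<Longrightarrow> g v \<in> A"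
  using assms(1) by (induction rule: W_induct) (simp_all add: assms(2))

lemma W_permutes: "g \<in> W q J \<Longrightarrow> g permutes verts49 (q + 8)"
proof (induction rule: W_induct)
  case id
  show ?case by (rule permutes_id)
next
  case (step k g)
  show ?case by (rule permutes_compose[OF step(2) rho_permutes])
qed

lemma W_permutation: "g \<in> W q J \<Longrightarrow> permutation g"
  by (rule permutes_imp_permutation[OF finite_verts W_permutes])

lemma W_even: "g \<in> W q J \<Longrightarrow> J \<subseteq> {..<q + 8} \<Longrightarrow> evenperm g"
proof -
  assume g: "g \<in> W q J" and J: "J \<subseteq> {..<q + 8}"
  from g have "evenperm g \<and> permutation g"
  proof (induction rule: W_induct)
    case (step k g)
    then have "evenperm (rho q k)" using rho_even J by blast
    moreover have "permutation (rho q k)"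
      by (rule permutes_imp_permutation[OF finite_verts rho_permutes])
    ultimately show ?case using step even_comp permutation_compose by blast
  qed simp
  then show ?thesis ..
qed

definition flip_on :: "nat set \<Rightarrow> vtx \<Rightarrow> vtx" where
  "flip_on S v = (case v of P i \<Rightarrow> P i | Y j \<Rightarrow> if j \<in> S then Z j else Y j | Z j \<Rightarrow> if j \<in> S then Y j else Z j)"

lemma flip_on_simps [simp]: "flip_on S (P i) = P i"
  "flip_on S (Y j) = (if j \<in> S then Z j else Y j)" "flip_on S (Z j) = (if j \<in> S then Y j else Z j)"
  by (simp_all add: flip_on_def)

lemma flip_on_comp: "flip_on S \<circ> flip_on T = flip_on ((S - T) \<union> (T - S))"
proof
  fix v show "(flip_on S \<circ> flip_on T) v = flip_on ((S - T) \<union> (T - S)) v"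
    by (cases v) auto
qed

lemma flip_on_empty: "flip_on {} = id"
proof
  fix v show "flip_on {} v = id v" by (cases v) auto
qed

lemma flip_on_singleton: "flip_on {k} = transpose (Y k) (Z k)"
proof
  fix v show "flip_on {k} v = transpose (Y k) (Z k) v" by (cases v) (auto simp: transpose_def)
qed

lemma lift_flip_on: "bij p \<Longrightarrow> lift p \<circ> flip_on S \<circ> lift (inv' p) = flip_on (p ` S)"
proof
  fix v assume p: "bij p"
  have *: "p (inv' p j) = j" "inv' p j \<in> S \<longleftrightarrow> j \<in> p ` S" for j
    using p by (auto simp: bij_is_surj surj_f_inv_f bij_is_inj intro!: image_eqI[of j p "inv' p j"])
  then show "(lift p \<circ> flip_on S \<circ> lift (inv' p)) v = flip_on (p ` S) v"
    by (cases v) auto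
qed

lemma rho_lift:
  assumes "3 \<le> k" "k \<le> q + 7" "k \<noteq> q + 4" "k \<noteq> q + 6"
  shows "rho q k = lift (transpose k (Suc k))"
proof
  fix v show "rho q k v = lift (transpose k (Suc k)) v"
    using assms by (cases v) (auto simp: rho_ge3 step_def transpose_def)
qed

lemma rho_q4: "rho q (q + 4) = flip_on {q + 6..q + 9} \<circ> lift (transpose (q + 4) (q + 5))"
proof
  fix v show "rho q (q + 4) v = (flip_on {q + 6..q + 9} \<circ> lift (transpose (q + 4) (q + 5))) v"
    by (cases v) (auto simp: rho_ge3 step_def transpose_def)
qed

lemma rho_q6: "rho q (q + 6) = lift (transpose (q + 8) (q + 9)) \<circ> lift (transpose (q + 6) (q + 7))"
proof
  fix v show "rho q (q + 6) v = (lift (transpose (q + 8) (q + 9)) \<circ> lift (transpose (q + 6) (q + 7))) v"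
    by (cases v) (auto simp: rho_ge3 step_def transpose_def)
qed

text \<open>The cube is trivial wherever two neighbours satisfy the braid relation. It survives at k
  = 2, q + 3, q + 4, q + 5, where the product has order 6, and there isolates the part of the
  generators that lies off the common paths of three points or twists them.\<close>

definition cube :: "nat \<Rightarrow> nat \<Rightarrow> vtx \<Rightarrow> vtx" where
  "cube q k = (rho q k \<circ> rho q (Suc k)) \<circ> (rho q k \<circ> rho q (Suc k)) \<circ> (rho q k \<circ> rho q (Suc k))"

lemma W_cube: "l = Suc k \<Longrightarrow> {k, l} \<subseteq> J \<Longrightarrow> cube q k \<in> W q J"
  unfolding cube_def by (intro W_comp W_rho) auto

lemma cube_2: "cube q 2 = transpose (P 3) (P 4) \<circ> transpose (Z 3) (Z 4)"
proof
  fix v show "cube q 2 v = (transpose (P 3) (P 4) \<circ> transpose (Z 3) (Z 4)) v"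
    by (cases v) (auto simp: cube_def rho.simps step_def transpose_def)
qed

text \<open>Singles out every index moved by a label from q + 3 on, so that each case is a
  computation.\<close>

lemma index_cases:
  obtains "j < q + 3" | "j = q + 3" | "j = q + 4" | "j = q + 5" | "j = q + 6" | "j = q + 7"
    | "j = q + 8" | "j = q + 9" | "q + 9 < (j::nat)"
  by linarith

lemma cube_q3: "cube q (q + 3) = flip_on {q + 6..q + 9}"
proof
  fix v show "cube q (q + 3) v = flip_on {q + 6..q + 9} v"
  proof (cases v)
    case (Y j) then show ?thesis
      by (cases j q rule: index_cases) (simp_all add: cube_def rho_ge3 step_def)
  next
    case (Z j) then show ?thesis
      by (cases j q rule: index_cases) (simp_all add: cube_def rho_ge3 step_def)
  qed (simp add: cube_def rho_ge3)
qed

lemma cube_q4: "cube q (q + 4) = flip_on {q + 4..q + 9}"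
proof
  fix v show "cube q (q + 4) v = flip_on {q + 4..q + 9} v"
  proof (cases v)
    case (Y j) then show ?thesis
      by (cases j q rule: index_cases) (simp_all add: cube_def rho_ge3 step_def)
  next
    case (Z j) then show ?thesis
      by (cases j q rule: index_cases) (simp_all add: cube_def rho_ge3 step_def)
  qed (simp add: cube_def rho_ge3)
qed

lemma cube_q5: "cube q (q + 5) = lift (transpose (q + 8) (q + 9))"
proof
  fix v show "cube q (q + 5) v = lift (transpose (q + 8) (q + 9)) v"
  proof (cases v)
    case (Y j) then show ?thesis
      by (cases j q rule: index_cases) (simp_all add: cube_def rho_ge3 step_def)
  next
    case (Z j) then show ?thesis
      by (cases j q rule: index_cases) (simp_all add: cube_def rho_ge3 step_def)
  qed (simp add: cube_def rho_ge3)
qed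

text \<open>The cube at q + 3 is precisely the rung part of the generator with label q + 4, so it
  strips the rungs off.\<close>

lemma adjacent_lift_q4:
  assumes "{q + 3, q + 4} \<subseteq> J"
  shows "lift (transpose (q + 4) (Suc (q + 4))) \<in> W q J"
proof -
  have "cube q (q + 3) \<circ> rho q (q + 4) = lift (transpose (q + 4) (q + 5))"
    by (simp add: cube_q3 rho_q4 comp_assoc[symmetric] flip_on_comp flip_on_empty)
  moreover have "cube q (q + 3) \<circ> rho q (q + 4) \<in> W q J"
    using assms by (intro W_comp W_cube[of "q + 4"] W_rho) auto
  moreover have "Suc (q + 4) = q + 5" by simp
  ultimately show ?thesis by (simp only:)
qed

text \<open>Likewise the cube at q + 5 is precisely the second pair of edges with label q +
  6.\<close>

lemma adjacent_lift_q6: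
  assumes "{q + 5, q + 6} \<subseteq> J"
  shows "lift (transpose (q + 6) (Suc (q + 6))) \<in> W q J"
proof -
  have "cube q (q + 5) \<circ> rho q (q + 6) = lift (transpose (q + 6) (q + 7))"
    by (simp add: cube_q5 rho_q6 comp_assoc[symmetric] lift_comp[symmetric] lift_id)
  moreover have "cube q (q + 5) \<circ> rho q (q + 6) \<in> W q J"
    using assms by (intro W_comp W_cube[of "q + 6"] W_rho) auto
  moreover have "Suc (q + 6) = q + 7" by simp
  ultimately show ?thesis by (simp only:)
qed

section \<open>Membership criteria for unsigned and even signed permutations\<close>

lemma diagonal_in:
  assumes H: "perm_subgroup H" and g: "bij g" and comm: "\<And>v. g (flip v) = flip (g v)"
    and P: "\<And>i. g (P i) = P i" and out: "\<And>k. k \<notin> {a..c} \<Longrightarrow> g (Y k) = Y k"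
    and diag: "\<And>k. k \<in> {a..c} \<Longrightarrow> \<exists>l. g (Y k) = Y l"
    and adj: "\<And>k. a \<le> k \<Longrightarrow> k < c \<Longrightarrow> lift (transpose k (Suc k)) \<in> H"
  shows "g \<in> H"
proof -
  obtain p where p: "p permutes {a..c}" and gp: "\<And>k. g (Y k) = Y (p k) \<or> g (Y k) = Z (p k)"
    using signed_decomposition[OF g comm P out] by blast
  have Y: "g (Y k) = Y (p k)" for k
    using gp[of k] diag[of k] out[of k] by (cases "k \<in> {a..c}") auto
  have "g = lift p"
  proof
    fix v show "g v = lift p v"
      using P Y comm[of "Y _"] by (cases v) auto
  qed
  then show ?thesis using lift_in[OF H adj p] by simp
qed

text \<open>Dividing by the lift of the block permutation leaves a pure sign change. For
  \<open>u = flip_on {m}\<close>, a link between \<open>Y k\<close> and \<open>Z k\<close> is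
  exactly the double flip at k and m, so \<open>linked_generates\<close> yields every even sign
  change.\<close>

lemma signed_in:
  assumes H: "perm_subgroup H" and even: "\<And>h. h \<in> H \<Longrightarrow> evenperm h \<and> permutation h"
    and g: "permutation g" "evenperm g" and comm: "\<And>v. g (flip v) = flip (g v)"
    and P: "\<And>i. g (P i) = P i" and out: "\<And>k. k \<notin> {a..c} \<Longrightarrow> g (Y k) = Y k"
    and adj: "\<And>k. a \<le> k \<Longrightarrow> k < c \<Longrightarrow> lift (transpose k (Suc k)) \<in> H"
    and flips: "\<And>k. k \<in> {a..c} \<Longrightarrow> flip_on {k} \<circ> flip_on {m} \<in> H"
  shows "g \<in> H"
proof -
  obtain p where p: "p permutes {a..c}" and gp: "\<And>k. g (Y k) = Y (p k) \<or> g (Y k) = Z (p k)"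
    using signed_decomposition[OF permutation_bijective[OF g(1)] comm P out] by blast
  have lp: "lift (inv' p) \<in> H" by (rule lift_in[OF H adj permutes_inv[OF p]])
  define h where "h = lift (inv' p) \<circ> g"
  have pp: "inv' p (p k) = k" for k using permutes_inverses(2)[OF p] .
  have hv: "h v = v \<or> h v = flip v" for v
  proof (cases v)
    case (P i)
    then show ?thesis using assms(6) by (simp add: h_def)
  next
    case (Y k)
    then show ?thesis using gp[of k] by (auto simp: h_def pp)
  next
    case (Z k)
    then show ?thesis using gp[of k] comm[of "Y k"] by (auto simp: h_def pp)
  qed
  have out': "h v = v" if "v = Y k \<or> v = Z k" "k \<notin> {a..c}" for v k
    using that out[of k] comm[of "Y k"] permutes_not_in[OF permutes_inv[OF p]] by (auto simp: h_def)
  have "linked H (flip_on {m}) v (h v)" for v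
  proof (cases v)
    case (P i)
    then show ?thesis by (simp add: h_def assms(6))
  next
    case (Y k)
    show ?thesis
    proof (cases "k \<in> {a..c}")
      case True
      then show ?thesis using hv[of v] flips[of k] Y by (auto simp: linked_def flip_on_singleton)
    qed (use out' Y in auto)
  next
    case (Z k)
    show ?thesis
    proof (cases "k \<in> {a..c}")
      case True
      then show ?thesis using hv[of v] flips[of k] Z
        by (auto simp: linked_def flip_on_singleton transpose_commute)
    qed (use out' Z in auto)
  qed
  moreover have "permutation h" "evenperm h"
    using g even[OF lp] by (auto simp: h_def intro: permutation_compose even_comp)
  moreover have "flip_on {m} \<circ> flip_on {m} = id" by (simp add: flip_on_comp flip_on_empty)
  ultimately have "h \<in> H" using linked_generates[OF H, of "flip_on {m}" h] by simp
  then show ?thesis unfolding h_def by (rule cancel_left[OF H lp])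
qed

section \<open>Constraints from final segments of labels\<close>

lemma left_fix_P1: "g \<in> W q {a..q + 7} \<Longrightarrow> 1 \<le> a \<Longrightarrow> g (P 1) = P 1"
  by (erule W_fix) (auto simp: rho.simps)

lemma left_fix_P2: "g \<in> W q {a..q + 7} \<Longrightarrow> 2 \<le> a \<Longrightarrow> g (P 2) = P 2"
  by (erule W_fix) (auto simp: rho.simps)

lemma left_P34: "g \<in> W q {a..q + 7} \<Longrightarrow> 2 \<le> a \<Longrightarrow> v \<in> {P 3, P 4} \<Longrightarrow> g v \<in> {P 3, P 4}"
  by (erule W_maps) (auto simp: rho.simps split: if_splits)

lemma left_fix_P: "g \<in> W q {a..q + 7} \<Longrightarrow> 3 \<le> a \<Longrightarrow> g (P i) = P i"
  by (erule W_fix) (auto simp: rho.simps)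

lemma left_fix_Y: "g \<in> W q {a..q + 7} \<Longrightarrow> 3 \<le> a \<Longrightarrow> k < a \<Longrightarrow> g (Y k) = Y k"
  by (erule W_fix) (auto simp: rho.simps step_def)

lemma left_flip: "g \<in> W q {a..q + 7} \<Longrightarrow> 3 \<le> a \<Longrightarrow> g (flip v) = flip (g v)"
proof -
  assume g: "g \<in> W q {a..q + 7}" and a: "3 \<le> a"
  from g have "\<forall>v. g (flip v) = flip (g v)"
    by (induction rule: W_induct) (use a in \<open>simp_all add: rho_flip\<close>)
  then show ?thesis ..
qed

lemma left_Y: "g \<in> W q {a..q + 7} \<Longrightarrow> q + 5 \<le> a \<Longrightarrow> \<exists>l. g (Y k) = Y l"
proof -
  assume "g \<in> W q {a..q + 7}" "q + 5 \<le> a"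
  then have "g (Y k) \<in> range Y"
    by (intro W_maps[of g q "{a..q + 7}"]) (auto simp: rho_ge3)
  then show ?thesis by blast
qed

lemma left_section:
  assumes g: "g \<in> W q {q + 4..q + 7}" and A: "A = insert (Z (q + 4)) (Y ` {q + 5..q + 9})"
  shows "(\<forall>v\<in>A. g v \<in> A) \<or> (\<forall>v\<in>A. g v \<in> flip ` A)"
  using g
proof (induction rule: W_induct)
  case (step k g)
  have F: "flip ` A = insert (Y (q + 4)) (Z ` {q + 5..q + 9})"
    unfolding A by (auto simp: image_iff)
  have "(rho q k v \<in> flip ` A \<longleftrightarrow> k = q + 4) \<and> (rho q k v \<in> A \<longleftrightarrow> k \<noteq> q + 4)" if "v \<in> A" for v
    using that step(1) unfolding F unfolding A by (auto simp: rho_ge3 step_def split: if_splits)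
  moreover have "(rho q k v \<in> flip ` A \<longleftrightarrow> k \<noteq> q + 4) \<and> (rho q k v \<in> A \<longleftrightarrow> k = q + 4)" if "v \<in> flip ` A" for v
    using that step(1) unfolding F unfolding A by (auto simp: rho_ge3 step_def split: if_splits)
  ultimately show ?case using step(2) by (cases "k = q + 4") auto
qed simp

text \<open>The labels along the indices q + 6 to q + 9 read q + 6, q + 7, q + 6 on both chains.
  This is a palindrome, so reversing the paths is an automorphism of the labelled graph for these
  two labels and commutes with the generators.\<close>

lemma left_reflection:
  assumes g: "g \<in> W q {q + 6..q + 7}"
    and mu: "mu = transpose (q + 6) (q + 9) \<circ> transpose (q + 7) (q + 8)"
  shows "g (lift mu v) = lift mu (g v)"
proof -
  have "rho q k (lift mu v) = lift mu (rho q k v)" if "k \<in> {q + 6..q + 7}" for k v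
  proof -
    have "k = q + 6 \<or> k = q + 7" using that by auto
    then show ?thesis unfolding mu
      by (cases v) (auto simp: rho_ge3 step_def transpose_def)
  qed
  note * = this
  from g have "\<forall>v. g (lift mu v) = lift mu (g v)"
    by (induction rule: W_induct) (simp_all add: *)
  then show ?thesis ..
qed

section \<open>Constraints from initial segments of labels\<close>

lemma right_fix: 
  assumes "g \<in> W q {..b}" "b \<le> q + 3" "b + 1 < k"
  shows "g (Y k) = Y k" "g (Z k) = Z k"
  using assms by (auto intro!: W_fix[OF assms(1)] simp: rho.simps step_def)

lemma right_Z: "g \<in> W q {..b} \<Longrightarrow> b \<le> q + 4 \<Longrightarrow> v \<in> Z ` {3..b + 1} \<Longrightarrow> g v \<in> Z ` {3..b + 1}"
  by (erule W_maps) (auto simp: rho.simps step_def)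

definition side :: "nat \<Rightarrow> nat \<Rightarrow> vtx set" where
  "side q c = Y ` {c..q + 9} \<union> Z ` {c..q + 9}"

text \<open>In both cases c = b + 2. Among the labels up to b only q + 4 moves an index from c on,
  and there it acts as \<open>flip\<close> on all blocks at once.\<close>

lemma right_side:
  assumes g: "g \<in> W q {..b}" and b: "b = q + 4 \<and> c = q + 6 \<or> b = q + 5 \<and> c = q + 7"
  shows "(\<forall>v\<in>side q c. g v = v) \<or> (\<forall>v\<in>side q c. g v = flip v)"
  using g
proof (induction rule: W_induct)
  case (step k g)
  have "rho q k v = (if k = q + 4 then flip v else v)" if "v \<in> side q c" for v
    using that step(1) b by (auto simp: side_def rho.simps step_def)
  moreover have "flip v \<in> side q c" if "v \<in> side q c" for v
    using that by (auto simp: side_def)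
  ultimately show ?case using step(2) by (cases "k = q + 4") auto
qed simp

text \<open>Now label q + 6 also acts on the side, through the last edges of the chains. It commutes
  with \<open>flip\<close>, so the induced group is a Klein four-group.\<close>

lemma right_side_q6:
  assumes g: "g \<in> W q {..q + 6}" and s: "s = lift (transpose (q + 8) (q + 9))"
  shows "\<exists>f\<in>{id, flip, s, flip \<circ> s}. \<forall>v\<in>side q (q + 8). g v = f v"
  using g
proof (induction rule: W_induct)
  case (step k g)
  have *: "rho q k v = (if k = q + 4 then flip v else if k = q + 6 then s v else v)"
    if "v \<in> side q (q + 8)" for v
    using that step(1) by (auto simp: side_def rho.simps step_def s transpose_def)
  have in_side: "flip v \<in> side q (q + 8)" "s v \<in> side q (q + 8)" if "v \<in> side q (q + 8)" for v
    using that by (auto simp: side_def s transpose_def)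
  have ss: "s (s v) = v" "s (flip v) = flip (s v)" for v by (cases v; simp add: s)+
  obtain f where f: "f \<in> {id, flip, s, flip \<circ> s}" "\<And>v. v \<in> side q (q + 8) \<Longrightarrow> g v = f v"
    using step(2) by blast
  define f' where "f' = (if k = q + 4 then flip else if k = q + 6 then s else id)"
  have "f v \<in> side q (q + 8)" if "v \<in> side q (q + 8)" for v
    using f(1) in_side that by auto
  then have "(rho q k \<circ> g) v = (f' \<circ> f) v" if "v \<in> side q (q + 8)" for v
    using that * f(2) by (simp add: f'_def)
  moreover have "f' \<circ> f \<in> {id, flip, s, flip \<circ> s}"
    using f(1) ss by (auto simp: f'_def fun_eq_iff)
  ultimately show ?case by blast
qed (auto simp: id_def)

section \<open>Intervals that fix the points P\<close>

lemma side_mem: "j \<in> {c..q + 9} \<Longrightarrow> Y j \<in> side q c" "j \<in> {c..q + 9} \<Longrightarrow> Z j \<in> side q c"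
  by (simp_all add: side_def)

lemma W_outside_fix: "g \<in> W q J \<Longrightarrow> v \<notin> verts49 (q + 8) \<Longrightarrow> g v = v"
  using W_permutes permutes_not_in by metis

lemma Y_outside: "q + 9 < k \<Longrightarrow> Y k \<notin> verts49 (q + 8)" "q + 9 < k \<Longrightarrow> Z k \<notin> verts49 (q + 8)"
  by (auto simp: verts49_def)

text \<open>Some element of the inner interval group agrees with \<open>g\<close> on the side blocks;
  dividing by it leaves an element of both outer groups that fixes these blocks pointwise.\<close>

lemma strip:
  assumes gb: "g \<in> W q {..b}" and ga: "g \<in> W q {a..q + 7}" and b: "b \<le> q + 7"
    and e: "e \<in> W q {a..b}" and ev: "\<And>v. v \<in> S \<Longrightarrow> e (g v) = v"
    and fixed: "\<And>h. h \<in> W q {..b} \<Longrightarrow> h \<in> W q {a..q + 7} \<Longrightarrow> (\<And>v. v \<in> S \<Longrightarrow> h v = v) \<Longrightarrow> h \<in> W q {a..b}"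
  shows "g \<in> W q {a..b}"
proof -
  have "e \<circ> g \<in> W q {..b}" by (rule W_comp[OF W_mono[OF _ e] gb]) auto
  moreover have "e \<circ> g \<in> W q {a..q + 7}" by (rule W_comp[OF W_mono[OF _ e] ga]) (use b in auto)
  ultimately have "e \<circ> g \<in> W q {a..b}" by (rule fixed) (use ev in simp)
  then show ?thesis by (rule W_cancel[OF e])
qed

lemma diagonal_from_Z:
  assumes "\<And>v. v \<in> Z ` {3..d} \<Longrightarrow> g v \<in> Z ` {3..d}" and "\<And>v. g (flip v) = flip (g v)"
    and "3 \<le> k" "k \<le> d"
  shows "\<exists>l. g (Y k) = Y l"
proof -
  have "g (Z k) \<in> Z ` {3..d}" using assms by auto
  then show ?thesis using assms(2)[of "Z k"] by auto
qed

text \<open>The rungs are out of reach: the group is the symmetric group on the indices a to b + 1,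
  acting simultaneously on both chains.\<close>

lemma interval_left_block_small:
  assumes a: "3 \<le> a" "a \<le> q + 7" and b: "b \<le> q + 3"
    and gb: "g \<in> W q {..b}" and ga: "g \<in> W q {a..q + 7}"
  shows "g \<in> W q {a..b}"
proof (rule diagonal_in[OF W_subgroup W_bij[OF ga] left_flip[OF ga a(1)] left_fix_P[OF ga a(1)]])
  show "g (Y k) = Y k" if "k \<notin> {a..b + 1}" for k
    using that left_fix_Y[OF ga a(1), of k] right_fix(1)[OF gb b, of k] by auto
  show "\<exists>l. g (Y k) = Y l" if "k \<in> {a..b + 1}" for k
    by (rule diagonal_from_Z[where g = g, OF right_Z[OF gb] left_flip[OF ga a(1)]]) (use that a b in auto)
  show "lift (transpose k (Suc k)) \<in> W q {a..b}" if "a \<le> k" "k < b + 1" for k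
    using rho_lift[of k q] W_rho[of k "{a..b}" q] that a b by auto
qed

text \<open>The fixed point \<open>Y (q + 9)\<close> rules out the exchange of the two blocks of
  \<open>left_section\<close>.\<close>

lemma section_preserved:
  assumes h: "h \<in> W q {q + 4..q + 7}" and fixed: "h (Y (q + 9)) = Y (q + 9)"
    and v: "v \<in> insert (Z (q + 4)) (Y ` {q + 5..q + 9})" (is "_ \<in> ?A")
  shows "h v \<in> insert (Z (q + 4)) (Y ` {q + 5..q + 9})"
proof -
  have "Y (q + 9) \<in> ?A" "Y (q + 9) \<notin> flip ` ?A" by auto
  then have "\<not> (\<forall>v\<in>?A. h v \<in> flip ` ?A)" using fixed by metis
  then show ?thesis using left_section[OF h refl] v by blast
qed

text \<open>Label q + 4 is present only through its chain edge and a common flip of the side. Once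
  that flip is divided out, \<open>right_Z\<close> keeps the chains apart and no signs
  remain.\<close>

lemma interval_block_q4:
  assumes a: "3 \<le> a" "a \<le> q + 7"
    and gb: "g \<in> W q {..q + 4}" and ga: "g \<in> W q {a..q + 7}"
  shows "g \<in> W q {a..q + 4}"
proof -
  have fixed: "h \<in> W q {a..q + 4}"
    if hb: "h \<in> W q {..q + 4}" and ha: "h \<in> W q {a..q + 7}" and hs: "\<And>v. v \<in> side q (q + 6) \<Longrightarrow> h v = v" for h
  proof -
    have out: "h (Y k) = Y k" if "k \<notin> {a..q + 5}" for k
    proof (cases "k < a")
      case True
      then show ?thesis using left_fix_Y[OF ha a(1)] by simp
    next
      case False
      then show ?thesis using that hs[OF side_mem(1)[of k "q + 6" q]] W_outside_fix[OF ha Y_outside(1)[of q k]]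
        by (cases "k \<le> q + 9") auto
    qed
    have diag: "\<exists>l. h (Y k) = Y l" if "3 \<le> k" "k \<le> q + 5" for k
      by (rule diagonal_from_Z[where g = h, OF right_Z[OF hb] left_flip[OF ha a(1)]]) (use that in auto)
    note dI = diagonal_in[OF W_subgroup W_bij[OF ha] left_flip[OF ha a(1)] left_fix_P[OF ha a(1)]]
    consider "a \<le> q + 3" | "a = q + 4" | "q + 5 \<le> a" by linarith
    then show ?thesis
    proof cases
      case 1
      show ?thesis
      proof (rule dI[of a "q + 5"])
        show "lift (transpose k (Suc k)) \<in> W q {a..q + 4}" if "a \<le> k" "k < q + 5" for k
          using rho_lift[of k q] W_rho[of k "{a..q + 4}" q] adjacent_lift_q4[of q "{a..q + 4}"] that a 1
          by (cases "k = q + 4") auto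
      qed (use out diag a in auto)
    next
      case 2
      have "h (Z (q + 4)) \<in> insert (Z (q + 4)) (Y ` {q + 5..q + 9})"
      proof -
        have "h (Y (q + 9)) = Y (q + 9)" using hs by (simp add: side_def)
        then show ?thesis using section_preserved[of h q "Z (q + 4)"] ha 2 by auto
      qed
      \<comment> \<open>\<open>h\<close> keeps \<open>Z (q + 4)\<close> on the Z chain, and
        \<open>Z (q + 4)\<close> is the only point of the preserved transversal there.\<close>
      then have Z4: "h (Z (q + 4)) = Z (q + 4)"
        using left_flip[OF ha a(1), of "Z (q + 4)"] diag[of "q + 4"] by auto
      show ?thesis
      proof (rule dI[of "q + 5" "q + 5"])
        show "h (Y k) = Y k" if "k \<notin> {q + 5..q + 5}" for k
        proof (cases "k = q + 4")
          case True
          then show ?thesis using Z4 left_flip[OF ha a(1), of "Z (q + 4)"] by simp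
        next
          case False
          then show ?thesis using out[of k] that 2 by auto
        qed
      qed (use diag in auto)
    next
      case 3
      show ?thesis by (rule dI[of a "q + 5"]) (use 3 out diag a in auto)
    qed
  qed
  have s: "(\<forall>v\<in>side q (q + 6). g v = v) \<or> (\<forall>v\<in>side q (q + 6). g v = flip v)"
    by (rule right_side[OF gb]) simp
  show ?thesis
  proof (cases "\<forall>v\<in>side q (q + 6). g v = v")
    case True
    then show ?thesis using fixed[OF gb ga] by blast
  next
    case False
    then have s: "g v = flip v" if "v \<in> side q (q + 6)" for v using s that by blast
    \<comment> \<open>Without label q + 4 the final segment cannot leave the Y chain, so it cannot
      flip the side.\<close>
    have "\<not> q + 5 \<le> a" using left_Y[OF ga, of "q + 9"] s[OF side_mem(1)[of "q + 9"]] by auto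
    then consider "a \<le> q + 3" | "a = q + 4" by linarith
    then show ?thesis
    proof cases
      case 1
      show ?thesis
      proof (rule strip[OF gb ga _ _ _ fixed])
        show "cube q (q + 3) \<in> W q {a..q + 4}" by (rule W_cube[of "q + 4"]) (use 1 in auto)
        show "cube q (q + 3) (g v) = v" if "v \<in> side q (q + 6)" for v
          using s[OF that] that by (auto simp: cube_q3 side_def)
      qed auto
    next
      case 2
      show ?thesis
      proof (rule strip[OF gb ga _ _ _ fixed])
        show "rho q (q + 4) \<in> W q {a..q + 4}" by (rule W_rho) (use 2 in auto)
        show "rho q (q + 4) (g v) = v" if "v \<in> side q (q + 6)" for v
          using s[OF that] that by (auto simp: rho_ge3 side_def)
      qed auto
    qed
  qed
qed

text \<open>A commutator: conjugating \<open>flip_on S\<close> by the swap replaces m by k in S, and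
  the symmetric difference of the two sets is {k, m}.\<close>

lemma double_flip:
  assumes p: "lift (transpose k m) \<in> W q J" and e: "flip_on S \<in> W q J" and "k \<notin> S" "m \<in> S"
  shows "flip_on {k} \<circ> flip_on {m} \<in> W q J"
proof -
  let ?p = "transpose k m"
  have "lift ?p \<circ> flip_on S \<circ> lift ?p \<circ> flip_on S \<in> W q J"
    using p e by (intro W_comp)
  moreover have "lift ?p \<circ> flip_on S \<circ> lift ?p = flip_on (?p ` S)"
    using lift_flip_on[of ?p S] by simp
  moreover have "?p ` S = insert k (S - {m})"
    using assms(3,4) by (auto simp: transpose_def image_iff)
  moreover have "(insert k (S - {m}) - S) \<union> (S - insert k (S - {m})) = {k, m}"
    "({k} - {m}) \<union> ({m} - {k}) = {k, m}"
    using assms(3,4) by auto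
  ultimately show ?thesis by (simp add: flip_on_comp)
qed

text \<open>For \<open>a = q + 4\<close> the group is a direct product of a symmetric group with the central swap of
  all blocks, but the transversal of the blocks preserved by the symmetric group contains \<open>Z (q + 4)\<close>
  instead of \<open>Y (q + 4)\<close>; conjugating by the transposition of these two points straightens it.\<close>

lemma twisted_section_in:
  assumes h: "h \<in> W q {q + 4..q + 7}" and c: "c \<in> {q + 6, q + 7}"
    and fixc: "\<And>k. c < k \<Longrightarrow> h (Y k) = Y k"
    and J: "{q + 4, q + 5} \<subseteq> J" and J': "c = q + 7 \<Longrightarrow> q + 6 \<in> J"
  shows "h \<in> W q J"
proof -
  define t where "t = flip_on {q + 4}"
  have tt: "t \<circ> t = id" by (simp add: t_def flip_on_comp flip_on_empty)
  have ttv: "t (t v) = v" for v using tt by (simp add: fun_eq_iff)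
  have tb: "bij t" by (rule o_bij[OF tt tt])
  have ti: "inv' t = t" by (rule inv_unique_comp[OF tt tt])
  define H where "H = {g. bij g \<and> t \<circ> g \<circ> t \<in> W q J}"
  have "perm_subgroup H"
    unfolding perm_subgroup_def H_def
  proof (intro conjI ballI CollectI)
    show "bij (id :: vtx \<Rightarrow> vtx)" by simp
    show "t \<circ> id \<circ> t \<in> W q J" using tt perm_subgroupD(1)[OF W_subgroup] by simp
    fix g assume "g \<in> {g. bij g \<and> t \<circ> g \<circ> t \<in> W q J}"
    then have g: "bij g" "t \<circ> g \<circ> t \<in> W q J" by auto
    show "bij g" by fact
    show "bij (inv' g)" using g by (simp add: bij_imp_bij_inv)
    have "inv' (t \<circ> g \<circ> t) = t \<circ> inv' g \<circ> t"
      using g tb by (simp add: o_inv_distrib bij_comp ti comp_assoc)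
    then show "t \<circ> inv' g \<circ> t \<in> W q J" using perm_subgroupD(4)[OF W_subgroup g(2)] by simp
    fix g' assume "g' \<in> {g. bij g \<and> t \<circ> g \<circ> t \<in> W q J}"
    then have g': "bij g'" "t \<circ> g' \<circ> t \<in> W q J" by auto
    show "bij (g \<circ> g')" using g g' by (simp add: bij_comp)
    have "(t \<circ> g \<circ> t) \<circ> (t \<circ> g' \<circ> t) = t \<circ> (g \<circ> g') \<circ> t" by (simp add: fun_eq_iff ttv)
    then show "t \<circ> (g \<circ> g') \<circ> t \<in> W q J" using W_comp[OF g(2) g'(2)] by simp
  qed
  moreover have "bij (t \<circ> h \<circ> t)" using W_bij[OF h] tb by (simp add: bij_comp)
  moreover have tf: "t (flip v) = flip (t v)" for v by (cases v) (auto simp: t_def)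
  have hf: "h (flip v) = flip (h v)" for v using left_flip[OF h] by simp
  have "(t \<circ> h \<circ> t) (flip v) = flip ((t \<circ> h \<circ> t) v)" for v by (simp add: tf hf)
  moreover have "(t \<circ> h \<circ> t) (P i) = P i" for i using left_fix_P[OF h] by (simp add: t_def)
  moreover have "(t \<circ> h \<circ> t) (Y k) = Y k" if "k \<notin> {q + 4..c}" for k
    using left_fix_Y[OF h, of k] fixc[of k] that c by (auto simp: t_def not_le)
  moreover have "\<exists>l. (t \<circ> h \<circ> t) (Y k) = Y l" if "k \<in> {q + 4..c}" for k
  proof -
    let ?A = "insert (Z (q + 4)) (Y ` {q + 5..q + 9})"
    have "h (Y (q + 9)) = Y (q + 9)" using fixc c by auto
    moreover have "t (Y k) \<in> ?A" using that c by (auto simp: t_def)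
    ultimately have "h (t (Y k)) \<in> ?A" by (rule section_preserved[OF h])
    then show ?thesis by (auto simp: t_def)
  qed
  moreover have "lift (transpose k (Suc k)) \<in> H" if "q + 4 \<le> k" "k < c" for k
  proof -
    have "c = q + 6 \<or> c = q + 7" using c by simp
    then have "k = q + 4 \<or> k = q + 5 \<or> k = q + 6 \<and> c = q + 7" using that by linarith
    then consider "k = q + 4" | "k = q + 5" | "k = q + 6" "c = q + 7" by blast
    then have "t \<circ> lift (transpose k (Suc k)) \<circ> t \<in> W q J"
    proof cases
      case 1
      \<comment> \<open>The cube flips all blocks from q + 4 on and thereby cancels the rungs of the
        generator; what remains is the swap of indices q + 4 and q + 5 with both signs
        changed.\<close>
      have "t \<circ> lift (transpose k (Suc k)) \<circ> t = cube q (q + 4) \<circ> rho q (q + 4)" (is "?l = ?r")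
      proof
        fix v show "?l v = ?r v"
          by (cases v) (auto simp: 1 cube_q4 rho_q4 t_def transpose_def)
      qed
      then show ?thesis using J by (auto intro!: W_comp W_rho W_cube[of "q + 5"])
    next
      case 2
      have "t \<circ> lift (transpose k (Suc k)) \<circ> t = rho q (q + 5)" (is "?l = ?r")
      proof
        fix v show "?l v = ?r v"
          by (cases v) (auto simp: 2 rho_lift t_def transpose_def)
      qed
      then show ?thesis using J by (auto intro!: W_rho)
    next
      case 3
      have "t \<circ> lift (transpose k (Suc k)) \<circ> t = lift (transpose k (Suc k))" (is "?l = ?r")
      proof
        fix v show "?l v = ?r v"
          by (cases v) (auto simp: 3 t_def transpose_def)
      qed
      then show ?thesis using adjacent_lift_q6[of q J] J J' 3 by auto
    qed
    then show ?thesis by (simp add: H_def lift_bij)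
  qed
  ultimately have "t \<circ> h \<circ> t \<in> H" by (rule diagonal_in)
  then have "t \<circ> (t \<circ> h \<circ> t) \<circ> t \<in> W q J" by (simp add: H_def)
  moreover have "t \<circ> (t \<circ> h \<circ> t) \<circ> t = h" by (simp add: fun_eq_iff ttv)
  ultimately show ?thesis by simp
qed

text \<open>Label q + 5 carries the chains to the rung at q + 6, so \<open>right_Z\<close> no longer
  applies. If q + 3 is available as well, even sign changes appear and \<open>signed_in\<close>
  replaces \<open>diagonal_in\<close>.\<close>

lemma interval_block_q5:
  assumes a: "3 \<le> a" "a \<le> q + 7"
    and gb: "g \<in> W q {..q + 5}" and ga: "g \<in> W q {a..q + 7}"
  shows "g \<in> W q {a..q + 5}"
proof -
  have fixed: "h \<in> W q {a..q + 5}"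
    if hb: "h \<in> W q {..q + 5}" and ha: "h \<in> W q {a..q + 7}" and hs: "\<And>v. v \<in> side q (q + 7) \<Longrightarrow> h v = v" for h
  proof -
    have right: "h (Y k) = Y k" if "q + 6 < k" for k
      using that hs[OF side_mem(1)[of k "q + 7" q]] W_outside_fix[OF ha Y_outside(1)[of q k]]
      by (cases "k \<le> q + 9") auto
    have out: "h (Y k) = Y k" if "k \<notin> {a..q + 6}" for k
      using left_fix_Y[OF ha a(1)] right that by (auto simp: not_le)
    consider "a \<le> q + 3" | "a = q + 4" | "q + 5 \<le> a" by linarith
    then show ?thesis
    proof cases
      case 1
      have adj: "lift (transpose k (Suc k)) \<in> W q {a..q + 5}" if "a \<le> k" "k < q + 6" for k
        using rho_lift[of k q] W_rho[of k "{a..q + 5}" q] adjacent_lift_q4[of q "{a..q + 5}"] that a 1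
        by (cases "k = q + 4") auto
      show ?thesis
      proof (rule signed_in[OF W_subgroup _ W_permutation[OF ha] W_even[OF ha] left_flip[OF ha a(1)] left_fix_P[OF ha a(1)] out adj])
        show "evenperm h' \<and> permutation h'" if "h' \<in> W q {a..q + 5}" for h'
          using W_permutation[OF that] by (auto intro!: W_even[OF that])
        \<comment> \<open>The index q + 6 is the only one in \<open>{a..q + 6}\<close> that also
          belongs to the rung set \<open>{q + 6..q + 9}\<close>, so \<open>double_flip\<close>
          covers every other k.\<close>
        show "flip_on {k} \<circ> flip_on {q + 6} \<in> W q {a..q + 5}" if k: "k \<in> {a..q + 6}" for k
        proof (cases "k = q + 6")
          case True
          then show ?thesis using perm_subgroupD(1)[OF W_subgroup] by (simp add: flip_on_comp flip_on_empty)
        next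
          case False
          have "lift (transpose k (q + 6)) \<in> W q {a..q + 5}"
            by (rule lift_in[OF W_subgroup adj permutes_swap_id]) (use k in auto)
          moreover have "flip_on {q + 6..q + 9} \<in> W q {a..q + 5}"
            using W_cube[of "q + 4" "q + 3" "{a..q + 5}" q] 1 by (simp add: cube_q3)
          ultimately show ?thesis by (rule double_flip) (use k False in auto)
        qed
      qed auto
    next
      case 2
      show ?thesis by (rule twisted_section_in[of h q "q + 6"]) (use ha right 2 in auto)
    next
      case 3
      show ?thesis
      proof (rule diagonal_in[OF W_subgroup W_bij[OF ha] left_flip[OF ha a(1)] left_fix_P[OF ha a(1)], of a "q + 6"])
        show "lift (transpose k (Suc k)) \<in> W q {a..q + 5}" if "a \<le> k" "k < q + 6" for k
          using rho_lift[of k q] W_rho[of k "{a..q + 5}" q] that 3 by auto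
      qed (use out left_Y[OF ha 3] in auto)
    qed
  qed
  have s: "(\<forall>v\<in>side q (q + 7). g v = v) \<or> (\<forall>v\<in>side q (q + 7). g v = flip v)"
    by (rule right_side[OF gb]) simp
  show ?thesis
  proof (cases "\<forall>v\<in>side q (q + 7). g v = v")
    case True
    then show ?thesis using fixed[OF gb ga] by blast
  next
    case False
    then have s: "g v = flip v" if "v \<in> side q (q + 7)" for v using s that by blast
    have "\<not> q + 5 \<le> a" using left_Y[OF ga, of "q + 9"] s[OF side_mem(1)[of "q + 9"]] by auto
    then consider "a \<le> q + 3" | "a = q + 4" by linarith
    then show ?thesis
    proof cases
      case 1
      show ?thesis
      proof (rule strip[OF gb ga _ _ _ fixed])
        show "cube q (q + 3) \<in> W q {a..q + 5}" by (rule W_cube[of "q + 4"]) (use 1 in auto)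
        show "cube q (q + 3) (g v) = v" if "v \<in> side q (q + 7)" for v
          using s[OF that] that by (auto simp: cube_q3 side_def)
      qed auto
    next
      case 2
      show ?thesis
      proof (rule strip[OF gb ga _ _ _ fixed])
        show "rho q (q + 4) \<in> W q {a..q + 5}" by (rule W_rho) (use 2 in auto)
        show "rho q (q + 4) (g v) = v" if "v \<in> side q (q + 7)" for v
          using s[OF that] that by (auto simp: rho_ge3 side_def)
      qed auto
    qed
  qed
qed

text \<open>The final segment excludes every side action that the interval cannot produce: a flip
  needs label q + 4, and the swap at the chain ends needs label q + 6. All four actions are
  involutions, so an \<open>e\<close> with the same side action as \<open>g\<close> undoes
  it.\<close>

lemma side_match_q6:
  assumes gb: "g \<in> W q {..q + 6}" and ga: "g \<in> W q {a..q + 7}"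
  shows "\<exists>e\<in>W q {a..q + 6}. \<forall>v\<in>side q (q + 8). e (g v) = v"
proof -
  define s where "s = lift (transpose (q + 8) (q + 9))"
  have e_flip: "\<exists>e\<in>W q {a..q + 6}. \<forall>v\<in>side q (q + 8). e v = flip v" if "a \<le> q + 4"
  proof (cases "a = q + 4")
    case True
    then show ?thesis
      by (intro bexI[of _ "rho q (q + 4)"] W_rho) (auto simp: side_def rho_ge3)
  next
    case False
    then have "cube q (q + 3) \<in> W q {a..q + 6}" using that by (intro W_cube[of "q + 4"]) auto
    then show ?thesis by (intro bexI[of _ "cube q (q + 3)"]) (auto simp: side_def cube_q3)
  qed
  have e_s: "\<exists>e\<in>W q {a..q + 6}. \<forall>v\<in>side q (q + 8). e v = s v" if "a \<le> q + 6"
    using that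
    by (intro bexI[of _ "rho q (q + 6)"] W_rho) (auto simp: side_def rho_ge3 step_def s_def transpose_def)
  obtain f where f: "f \<in> {id, flip, s, flip \<circ> s}" and gf: "\<And>v. v \<in> side q (q + 8) \<Longrightarrow> g v = f v"
    using right_side_q6[OF gb s_def] by blast
  have side_closed: "flip v \<in> side q (q + 8)" "s v \<in> side q (q + 8)" if "v \<in> side q (q + 8)" for v
    using that by (auto simp: side_def s_def transpose_def)
  have ss: "s (s v) = v" "s (flip v) = flip (s v)" for v by (cases v; simp add: s_def)+
  have gY9: "g (Y (q + 9)) = f (Y (q + 9))" by (simp add: gf side_mem)
  have a4: "a \<le> q + 4" if "f = flip \<or> f = flip \<circ> s"
  proof (rule ccontr)
    assume "\<not> a \<le> q + 4"
    then show False using left_Y[OF ga, of "q + 9"] gY9 that by (auto simp: s_def)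
  qed
  have a6: "a \<le> q + 6" if "f = s"
  proof (rule ccontr)
    assume "\<not> a \<le> q + 6"
    then have "g (Y (q + 9)) = Y (q + 9)" by (intro W_fix[OF ga]) (auto simp: rho_ge3 step_def)
    then show False using gY9 that by (simp add: s_def)
  qed
  have "\<exists>e\<in>W q {a..q + 6}. \<forall>v\<in>side q (q + 8). e v = f v"
  proof -
    consider "f = id" | "f = flip" | "f = s" | "f = flip \<circ> s" using f by auto
    then show ?thesis
    proof cases
      case 1
      then show ?thesis using perm_subgroupD(1)[OF W_subgroup] by (intro bexI[of _ id]) auto
    next
      case 2
      then show ?thesis using e_flip a4 by auto
    next
      case 3
      then show ?thesis using e_s a6 by auto
    next
      case 4
      then obtain e1 e2 where "e1 \<in> W q {a..q + 6}" "e2 \<in> W q {a..q + 6}"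
          "\<And>v. v \<in> side q (q + 8) \<Longrightarrow> e1 v = flip v" "\<And>v. v \<in> side q (q + 8) \<Longrightarrow> e2 v = s v"
        using e_flip e_s a4 by force
      then show ?thesis using side_closed 4 by (intro bexI[of _ "e1 \<circ> e2"] W_comp) auto
    qed
  qed
  then obtain e where e: "e \<in> W q {a..q + 6}" "\<And>v. v \<in> side q (q + 8) \<Longrightarrow> e v = f v" by blast
  have "e (g v) = v" if v: "v \<in> side q (q + 8)" for v
  proof -
    have "f v \<in> side q (q + 8)" using f side_closed v by auto
    then have "e (g v) = f (f v)" using e(2) gf[OF v] by simp
    then show ?thesis using f ss by auto
  qed
  then show ?thesis using e(1) by blast
qed

text \<open>The starting labels differ in kind: even signed permutations for a up to q + 3, the
  twisted transversal at q + 4, index permutations at q + 5, and from q + 6 on nothing but the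
  identity after stripping.\<close>

lemma interval_block_q6:
  assumes a: "3 \<le> a" "a \<le> q + 7"
    and gb: "g \<in> W q {..q + 6}" and ga: "g \<in> W q {a..q + 7}"
  shows "g \<in> W q {a..q + 6}"
proof -
  have fixed: "h \<in> W q {a..q + 6}"
    if hb: "h \<in> W q {..q + 6}" and ha: "h \<in> W q {a..q + 7}" and hs: "\<And>v. v \<in> side q (q + 8) \<Longrightarrow> h v = v" for h
  proof -
    have right: "h (Y k) = Y k" if "q + 7 < k" for k
      using that hs[OF side_mem(1)[of k "q + 8" q]] W_outside_fix[OF ha Y_outside(1)[of q k]]
      by (cases "k \<le> q + 9") auto
    have out: "h (Y k) = Y k" if "k \<notin> {a..q + 7}" for k
      using left_fix_Y[OF ha a(1)] right that by (auto simp: not_le)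
    note dI = diagonal_in[OF W_subgroup W_bij[OF ha] left_flip[OF ha a(1)] left_fix_P[OF ha a(1)]]
    consider "a \<le> q + 3" | "a = q + 4" | "a = q + 5" | "a = q + 6" | "a = q + 7" using a by linarith
    then show ?thesis
    proof cases
      case 1
      have adj: "lift (transpose k (Suc k)) \<in> W q {a..q + 6}" if "a \<le> k" "k < q + 7" for k
        using rho_lift[of k q] W_rho[of k "{a..q + 6}" q] adjacent_lift_q4[of q "{a..q + 6}"]
          adjacent_lift_q6[of q "{a..q + 6}"] that a 1
        by (cases "k = q + 4"; cases "k = q + 6") auto
      have swap: "lift (transpose k l) \<in> W q {a..q + 6}" if "k \<in> {a..q + 7}" "l \<in> {a..q + 7}" for k l
        by (rule lift_in[OF W_subgroup adj permutes_swap_id]) (use that in auto)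
      have e: "flip_on {q + 6..q + 9} \<in> W q {a..q + 6}"
        using W_cube[of "q + 4" "q + 3" "{a..q + 6}" q] 1 by (simp add: cube_q3)
      have far: "flip_on {k} \<circ> flip_on {m} \<in> W q {a..q + 6}"
        if "k \<in> {a..q + 5}" "m \<in> {q + 6, q + 7}" for k m
        using double_flip[OF swap[of k m] e] that by auto
      \<comment> \<open>Both indices lie in the rung set, so \<open>double_flip\<close> does not
        apply directly. The detour through q + 3, which lies outside it, flips that block
        twice.\<close>
      have near: "flip_on {q + 6} \<circ> flip_on {q + 7} \<in> W q {a..q + 6}"
      proof -
        have "(flip_on {q + 3} \<circ> flip_on {q + 6}) \<circ> (flip_on {q + 3} \<circ> flip_on {q + 7}) \<in> W q {a..q + 6}"
          by (rule W_comp[OF far far]) (use 1 in auto)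
        moreover have "(flip_on {q + 3} \<circ> flip_on {q + 6}) \<circ> (flip_on {q + 3} \<circ> flip_on {q + 7})
            = flip_on {q + 6} \<circ> flip_on {q + 7}" (is "?l = ?r")
        proof
          fix v show "?l v = ?r v" by (cases v) auto
        qed
        ultimately show ?thesis by simp
      qed
      show ?thesis
      proof (rule signed_in[OF W_subgroup _ W_permutation[OF ha] W_even[OF ha] left_flip[OF ha a(1)] left_fix_P[OF ha a(1)] out adj])
        show "evenperm h' \<and> permutation h'" if "h' \<in> W q {a..q + 6}" for h'
          using W_permutation[OF that] by (auto intro!: W_even[OF that])
        show "flip_on {k} \<circ> flip_on {q + 7} \<in> W q {a..q + 6}" if k: "k \<in> {a..q + 7}" for k
        proof -
          have "k \<in> {a..q + 5} \<or> k = q + 6 \<or> k = q + 7" using k by auto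
          then consider "k \<in> {a..q + 5}" | "k = q + 6" | "k = q + 7" by blast
          then show ?thesis
          proof cases
            case 3
            then show ?thesis using perm_subgroupD(1)[OF W_subgroup] by (simp add: flip_on_comp flip_on_empty)
          qed (use far near in auto)
        qed
      qed auto
    next
      case 2
      show ?thesis by (rule twisted_section_in[of h q "q + 7"]) (use ha right 2 in auto)
    next
      case 3
      show ?thesis
      proof (rule dI[of a "q + 7"])
        show "lift (transpose k (Suc k)) \<in> W q {a..q + 6}" if "a \<le> k" "k < q + 7" for k
          using rho_lift[of k q] W_rho[of k "{a..q + 6}" q] adjacent_lift_q6[of q "{a..q + 6}"] that 3
          by (cases "k = q + 6") auto
      qed (use out left_Y[OF ha] 3 in auto)
    next
      case 4
      \<comment> \<open>The path reversal carries the fixed indices q + 8 and q + 9 to q + 7 and q +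
        6.\<close>
      have "h (Y k) = Y k" if "k = q + 6 \<or> k = q + 7" for k
        using left_reflection[OF ha[unfolded 4] refl, of "Y k"] right[of "q + 8"] right[of "q + 9"] that
        by (cases "h (Y k)") (auto simp: transpose_def split: if_splits)
      then have "h (Y k) = Y k" for k using out[of k] 4 by (cases "k = q + 6 \<or> k = q + 7") auto
      \<comment> \<open>Every index is fixed, so the empty interval \<open>{1..0}\<close> serves and
        the remaining obligations are vacuous.\<close>
      then show ?thesis by (intro dI[of 1 0]) auto
    next
      case 5
      show ?thesis
        by (rule dI[of "q + 7" "q + 7"]) (use out left_Y[OF ha] 5 in auto)
    qed
  qed
  obtain e where e: "e \<in> W q {a..q + 6}" "\<And>v. v \<in> side q (q + 8) \<Longrightarrow> e (g v) = v"
    using side_match_q6[OF gb ga] by blast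
  show ?thesis by (rule strip[OF gb ga _ e fixed]) simp_all
qed

section \<open>Intervals that move the points P\<close>

abbreviation swap34 :: "vtx \<Rightarrow> vtx" where
  "swap34 \<equiv> transpose (P 3) (P 4)"

lemma link_step:
  assumes "linked (W q J) swap34 x y" and "k \<in> J" "3 \<le> k" "k \<le> q + 7"
    and "rho q k x = x'" "rho q k y = y'"
  shows "linked (W q J) swap34 x' y'"
proof -
  have "rho q k \<circ> swap34 = swap34 \<circ> rho q k"
  proof
    fix v show "(rho q k \<circ> swap34) v = (swap34 \<circ> rho q k) v"
      using assms(3,4) by (cases v) (auto simp: rho_ge3 transpose_def)
  qed
  then show ?thesis
    using linked_image[OF W_subgroup _ W_rho[OF assms(2)] rho_invol _ assms(1,5,6)] by simp
qed

lemma link_P34: "linked (W q J) swap34 (P 3) (P 4)"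
  using perm_subgroupD(1)[OF W_subgroup] by (simp add: linked_def)

lemma rho_2: "rho q 2 = transpose (Y 2) (Y 3) \<circ> swap34"
proof
  fix v show "rho q 2 v = (transpose (Y 2) (Y 3) \<circ> swap34) v"
    by (cases v) (auto simp: rho.simps transpose_def)
qed

text \<open>The generator with label 2 provides the seed {Y 2, Y 3}. Each label k from 3 on fixes
  \<open>Y 2\<close> and commutes with \<open>swap34\<close>, so it carries the link one edge
  further.\<close>

lemma link_Y:
  assumes J: "{2..b} \<subseteq> J" and b: "b \<le> q + 7" and k: "2 \<le> k" "k \<le> b + 1"
  shows "linked (W q J) swap34 (Y 2) (Y k)"
  using k
proof (induction k)
  case (Suc k)
  consider "k = 1" | "k = 2" | "3 \<le> k" using Suc.prems by linarith
  then show ?case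
  proof cases
    case 1
    then show ?thesis by (simp add: numeral_2_eq_2)
  next
    case 2
    then have "rho q 2 \<in> W q J" using J Suc.prems by (intro W_rho) auto
    then show ?thesis using 2 by (simp add: linked_def rho_2)
  next
    case 3
    then have "linked (W q J) swap34 (Y 2) (Y k)" using Suc by simp
    then show ?thesis
      by (rule link_step[of _ _ _ _ k]) (use 3 J b Suc.prems in \<open>auto simp: rho_ge3 step_def\<close>)
  qed
qed simp

lemma cube_2_commute: "cube q 2 = transpose (Z 3) (Z 4) \<circ> swap34"
proof
  fix v show "cube q 2 v = (transpose (Z 3) (Z 4) \<circ> swap34) v"
    unfolding cube_2 by (cases v) (auto simp: transpose_def)
qed

lemma link_Z34:
  assumes "{2, 3} \<subseteq> J"
  shows "linked (W q J) swap34 (Z 3) (Z 4)"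
  using W_cube[of 3 2 J q] assms by (simp add: linked_def cube_2_commute)

lemma link_Z:
  assumes J: "{2..b} \<subseteq> J" and b: "b \<le> q + 7" and k: "3 \<le> k" "k \<le> b + 1"
  shows "linked (W q J) swap34 (Z 3) (Z k)"
  using k
proof (induction k)
  case (Suc k)
  consider "k = 2" | "k = 3" | "4 \<le> k" using Suc.prems by linarith
  then show ?case
  proof cases
    case 1
    then show ?thesis by (simp add: numeral_3_eq_3)
  next
    case 2
    \<comment> \<open>Label 3 moves the base point \<open>Z 3\<close>, so this first link has to
      come from the cube at label 2.\<close>
    then have "{2, 3} \<subseteq> J" using J Suc.prems by auto
    then show ?thesis using link_Z34[of J q] 2 by simp
  next
    case 3
    then have "linked (W q J) swap34 (Z 3) (Z k)" using Suc by simp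
    then show ?thesis
      by (rule link_step[of _ _ _ _ k]) (use 3 J b Suc.prems in \<open>auto simp: rho_ge3 step_def\<close>)
  qed
qed simp

text \<open>The chains are joined by the rung at q + 6: label q + 4 fixes \<open>Y 2\<close> and
  sends \<open>Y (q + 6)\<close> to \<open>Z (q + 6)\<close>. The bound on b ensures that
  \<open>Y (q + 6)\<close> is already linked.\<close>

lemma link_YZ:
  assumes J: "{2..b} \<subseteq> J" and b: "q + 5 \<le> b" "b \<le> q + 7" and k: "3 \<le> k" "k \<le> b + 1"
  shows "linked (W q J) swap34 (Y 2) (Z k)"
proof -
  note trans = linked_trans[OF W_subgroup transpose_comp_involutory]
  have "linked (W q J) swap34 (Y 2) (Y (q + 6))" by (rule link_Y[OF J b(2)]) (use b in auto)
  then have "linked (W q J) swap34 (Y 2) (Z (q + 6))"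
    by (rule link_step[of _ _ _ _ "q + 4"]) (use J b in \<open>auto simp: rho_ge3 step_def\<close>)
  moreover have "linked (W q J) swap34 (Z (q + 6)) (Z 3)"
    by (rule linked_sym, rule link_Z[OF J b(2)]) (use b in auto)
  moreover have "linked (W q J) swap34 (Z 3) (Z k)" by (rule link_Z[OF J b(2) k])
  ultimately show ?thesis using trans by blast
qed

text \<open>Label 1 conjugates \<open>swap34\<close> to \<open>transpose (P 2) (Y 2)\<close>.
  Applied to the link of \<open>Z 3\<close> and \<open>Z 4\<close>, which label 1 fixes, it changes
  only \<open>u\<close>; comparing with the original link isolates
  \<open>transpose (P 2) (Y 2) \<circ> swap34\<close>. This element then corrects the conjugate of
  the link between \<open>Y 2\<close> and \<open>Y 3\<close>.\<close>

lemma link_P: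
  assumes J: "{1, 2, 3} \<subseteq> J"
  shows "linked (W q J) swap34 (Y 2) (P 2)" "linked (W q J) swap34 (Y 3) (P 4)"
proof -
  note H = W_subgroup[of q J]
  have uu: "swap34 \<circ> swap34 = id" by simp
  have r1: "rho q 1 \<in> W q J" using J by (intro W_rho) auto
  have r1s: "rho q 1 \<circ> swap34 \<circ> rho q 1 = transpose (P 2) (Y 2)"
    unfolding conj_transpose[OF rho_invol] by (simp add: rho.simps)
  have "linked (W q J) swap34 (Z 3) (Z 4)" using J by (intro link_Z34) auto
  then have zs: "transpose (Z 3) (Z 4) \<circ> swap34 \<in> W q J" by (simp add: linked_def)
  have "transpose (Z 3) (Z 4) \<circ> transpose (P 2) (Y 2) \<in> W q J"
    using conj_linked[OF H uu r1 rho_invol \<open>linked (W q J) swap34 (Z 3) (Z 4)\<close>]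
    unfolding r1s by (simp add: rho.simps)
  then have "inv' (transpose (Z 3) (Z 4) \<circ> transpose (P 2) (Y 2)) \<in> W q J"
    by (rule perm_subgroupD(4)[OF H])
  then have "transpose (P 2) (Y 2) \<circ> transpose (Z 3) (Z 4) \<in> W q J"
    by (simp add: o_inv_distrib)
  then have "(transpose (P 2) (Y 2) \<circ> transpose (Z 3) (Z 4)) \<circ> (transpose (Z 3) (Z 4) \<circ> swap34) \<in> W q J"
    using zs by (rule W_comp)
  moreover have "(transpose (P 2) (Y 2) \<circ> transpose (Z 3) (Z 4)) \<circ> (transpose (Z 3) (Z 4) \<circ> swap34)
      = transpose (P 2) (Y 2) \<circ> swap34" by (simp add: fun_eq_iff)
  ultimately have py: "transpose (P 2) (Y 2) \<circ> swap34 \<in> W q J" by simp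
  then show "linked (W q J) swap34 (Y 2) (P 2)" by (simp add: linked_def transpose_commute)
  have "{2..2} \<subseteq> J" using J by auto
  then have "linked (W q J) swap34 (Y 2) (Y 3)" by (rule link_Y) auto
  from conj_linked[OF H uu r1 rho_invol this]
  have "transpose (P 4) (Y 3) \<circ> transpose (P 2) (Y 2) \<in> W q J"
    unfolding r1s by (simp add: rho.simps)
  then have "(transpose (P 4) (Y 3) \<circ> transpose (P 2) (Y 2)) \<circ> (transpose (P 2) (Y 2) \<circ> swap34) \<in> W q J"
    using py by (rule W_comp)
  moreover have "(transpose (P 4) (Y 3) \<circ> transpose (P 2) (Y 2)) \<circ> (transpose (P 2) (Y 2) \<circ> swap34)
      = transpose (P 4) (Y 3) \<circ> swap34" by (simp add: fun_eq_iff)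
  ultimately show "linked (W q J) swap34 (Y 3) (P 4)" by (simp add: linked_def transpose_commute)
qed

lemma link_P':
  assumes J: "{1, 2, 3} \<subseteq> J" and i: "i \<in> {2, 3, 4}"
  shows "linked (W q J) swap34 (Y 2) (P i)"
proof -
  note trans = linked_trans[OF W_subgroup transpose_comp_involutory]
  have "{2..2} \<subseteq> J" using J by auto
  then have "linked (W q J) swap34 (Y 2) (Y 3)" by (rule link_Y) auto
  then have 4: "linked (W q J) swap34 (Y 2) (P 4)" using link_P(2)[OF J] trans by blast
  then have "linked (W q J) swap34 (Y 2) (P 3)" using linked_sym[OF link_P34] trans by blast
  then show ?thesis using 4 link_P(1)[OF J] i by auto
qed

lemma all_even_perms:
  assumes g: "g permutes verts49 (q + 8)" "evenperm g"
  shows "g \<in> W q {..<q + 8}"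
proof -
  let ?J = "{..<q + 8}"
  note trans = linked_trans[OF W_subgroup transpose_comp_involutory]
  have J: "{2..q + 7} \<subseteq> ?J" "{1, 2, 3} \<subseteq> ?J" by auto
  have Y: "linked (W q ?J) swap34 (Y 2) (Y k)" if "2 \<le> k" "k \<le> q + 8" for k
    by (rule link_Y[OF J(1)]) (use that in auto)
  have Z: "linked (W q ?J) swap34 (Y 2) (Z k)" if "3 \<le> k" "k \<le> q + 8" for k
    by (rule link_YZ[OF J(1)]) (use that in auto)
  \<comment> \<open>\<open>link_Y\<close> stops at index q + 8, since the last edge of the chain
    carries label q + 6.\<close>
  have Y9: "linked (W q ?J) swap34 (Y 2) (Y (q + 9))"
    by (rule link_step[OF Y[of "q + 8"], of "q + 6"]) (auto simp: rho_ge3 step_def)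
  have Z9: "linked (W q ?J) swap34 (Y 2) (Z (q + 9))"
    by (rule link_step[OF Z[of "q + 8"], of "q + 6"]) (auto simp: rho_ge3 step_def)
  have "rho q 0 = transpose (P 1) (P 2) \<circ> swap34"
  proof
    fix v show "rho q 0 v = (transpose (P 1) (P 2) \<circ> swap34) v"
      by (cases v) (auto simp: rho.simps transpose_def)
  qed
  then have "linked (W q ?J) swap34 (P 2) (P 1)"
    using W_rho[of 0 ?J q] by (simp add: linked_def transpose_commute)
  then have P1: "linked (W q ?J) swap34 (Y 2) (P 1)" using link_P(1)[OF J(2)] trans by blast
  have all: "linked (W q ?J) swap34 (Y 2) v" if "v \<in> verts49 (q + 8)" for v
  proof (cases v)
    case (P i)
    then have "i = 1 \<or> i \<in> {2, 3, 4}" using that by (auto simp: verts49_def)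
    then show ?thesis using P P1 link_P'[OF J(2)] by auto
  next
    case v: (Y k)
    then have "2 \<le> k" "k \<le> q + 8 \<or> k = q + 9" using that by (auto simp: verts49_def)
    then show ?thesis using v Y Y9 by auto
  next
    case v: (Z k)
    then have "3 \<le> k" "k \<le> q + 8 \<or> k = q + 9" using that by (auto simp: verts49_def)
    then show ?thesis using v Z Z9 by auto
  qed
  have "linked (W q ?J) swap34 v (g v)" for v
  proof (cases "v \<in> verts49 (q + 8)")
    case True
    then have "g v \<in> verts49 (q + 8)" using permutes_in_image[OF g(1)] by blast
    then show ?thesis by (rule trans[OF linked_sym[OF all[OF True]] all])
  qed (simp add: permutes_not_in[OF g(1)])
  then show ?thesis
    using linked_generates[OF W_subgroup _ permutes_imp_permutation[OF finite_verts g(1)], of swap34] g(2)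
    by simp
qed

lemma maps_into_inj:
  assumes "finite D" "inj h" "\<And>v. v \<in> D \<Longrightarrow> h v \<in> D" "h v \<in> D"
  shows "v \<in> D"
proof -
  have "h ` D = D" using assms by (intro endo_inj_surj) (auto intro: inj_on_subset)
  then show ?thesis using assms(2,4) by (metis image_iff injD)
qed

text \<open>Each of \<open>C\<close>, \<open>D\<close>, \<open>E\<close> lies in one linked class:
  \<open>C\<close> contains \<open>Y 2\<close>, \<open>D\<close> is the Z chain as long as no rung
  joins it to \<open>C\<close>, and \<open>E\<close> is the pair \<open>P 3\<close>,
  \<open>P 4\<close> when label 1 is absent. The initial segment preserves \<open>D\<close>, the
  final segment preserves \<open>E\<close>, and injectivity then forces \<open>C\<close> to be
  preserved. Evenness does the rest.\<close>

lemma interval_path_stripped: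
  assumes a: "a = 1 \<and> 3 \<le> b \<or> a = 2 \<and> 2 \<le> b" and b: "b \<le> q + 6"
    and hb: "h \<in> W q {..b}" and ha: "h \<in> W q {a..q + 7}"
    and hs: "\<And>k. b + 1 < k \<Longrightarrow> h (Y k) = Y k \<and> h (Z k) = Z k"
  shows "h \<in> W q {a..b}"
proof -
  let ?L = "linked (W q {a..b}) swap34"
  note trans = linked_trans[OF W_subgroup transpose_comp_involutory]
  have inj: "inj h" using W_bij[OF ha] by (rule bij_is_inj)
  have J: "{2..b} \<subseteq> {a..b}" using a by auto
  define D where "D = (if q + 5 \<le> b then {} else Z ` {3..b + 1})"
  define E where "E = (if a = 2 then {P 3, P 4} else {})"
  define C where "C = (if a = 1 then {P 2, P 3, P 4} else {}) \<union> Y ` {2..b + 1}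
    \<union> (if q + 5 \<le> b then Z ` {3..b + 1} else {})"
  have C: "?L (Y 2) v" if "v \<in> C" for v
  proof -
    have "(\<exists>i. a = 1 \<and> v = P i \<and> i \<in> {2, 3, 4}) \<or> (\<exists>k. v = Y k \<and> 2 \<le> k \<and> k \<le> b + 1)
        \<or> (\<exists>k. v = Z k \<and> q + 5 \<le> b \<and> 3 \<le> k \<and> k \<le> b + 1)"
      using that by (auto simp: C_def split: if_splits)
    then show ?thesis
    proof (elim disjE exE conjE)
      fix i assume i: "a = 1" "v = P i" "i \<in> {2, 3, 4}"
      show ?thesis unfolding i(2) by (rule link_P'[OF _ i(3)]) (use a i(1) in auto)
    next
      fix k assume k: "v = Y k" "2 \<le> k" "k \<le> b + 1"
      show ?thesis unfolding k(1) by (rule link_Y[OF J _ k(2,3)]) (use b in simp)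
    next
      fix k assume k: "v = Z k" "q + 5 \<le> b" "3 \<le> k" "k \<le> b + 1"
      show ?thesis unfolding k(1) by (rule link_YZ[OF J k(2) _ k(3,4)]) (use b in simp)
    qed
  qed
  have D: "?L (Z 3) v" if v: "v \<in> D" for v
  proof -
    obtain k where k: "v = Z k" "3 \<le> k" "k \<le> b + 1" using v by (auto simp: D_def split: if_splits)
    show ?thesis unfolding k(1) by (rule link_Z[OF J _ k(2,3)]) (use b in simp)
  qed
  have E: "?L (P 3) v" if "v \<in> E" for v
    using that link_P34 by (auto simp: E_def split: if_splits)
  have hD: "h v \<in> D" if "v \<in> D" for v
    using that right_Z[OF hb, of v] by (auto simp: D_def split: if_splits)
  have hE: "h v \<in> E" if "v \<in> E" for v
    using that left_P34[OF ha, of v] by (auto simp: E_def split: if_splits)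
  have fixed: "h v = v" if "v \<notin> C \<union> D \<union> E" for v
  proof (cases "v \<in> verts49 (q + 8)")
    case True
    show ?thesis
    proof (cases v)
      case (P i)
      then have "i = 1 \<or> a = 2 \<and> i = 2" using True that a by (auto simp: verts49_def C_def E_def)
      then show ?thesis using P left_fix_P1[OF ha] left_fix_P2[OF ha] a by auto
    next
      case (Y k)
      then have "b + 1 < k" using True that by (auto simp: verts49_def C_def)
      then show ?thesis using hs Y by simp
    next
      case (Z k)
      then have "b + 1 < k" using True that by (auto simp: verts49_def C_def D_def split: if_splits)
      then show ?thesis using hs Z by simp
    qed
  qed (rule W_outside_fix[OF ha])
  have "?L v (h v)" for v
  proof -
    consider "v \<in> C" "v \<notin> D" "v \<notin> E" | "v \<in> D" | "v \<in> E" | "v \<notin> C \<union> D \<union> E" by blast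
    then show ?thesis
    proof cases
      case 1
      have "h v \<notin> D" using maps_into_inj[OF _ inj hD, of v] 1 by (auto simp: D_def)
      moreover have "h v \<notin> E" using maps_into_inj[OF _ inj hE, of v] 1 by (auto simp: E_def)
      moreover have "h v \<in> C \<union> D \<union> E"
      proof (rule ccontr)
        assume n: "h v \<notin> C \<union> D \<union> E"
        then have "h (h v) = h v" by (rule fixed)
        then have "h v = v" using inj by (simp add: inj_eq)
        then show False using n 1 by simp
      qed
      ultimately have "h v \<in> C" by blast
      then show ?thesis by (rule trans[OF linked_sym[OF C[OF 1(1)]] C])
    next
      case 2
      show ?thesis by (rule trans[OF linked_sym[OF D[OF 2]] D[OF hD[OF 2]]])
    next
      case 3
      show ?thesis by (rule trans[OF linked_sym[OF E[OF 3]] E[OF hE[OF 3]]])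
    next
      case 4
      then show ?thesis using fixed by simp
    qed
  qed
  then have "if evenperm h then h \<in> W q {a..b} else swap34 \<circ> h \<in> W q {a..b}"
    by (intro linked_generates[OF W_subgroup _ W_permutation[OF ha]]) auto
  moreover have "evenperm h" by (rule W_even[OF ha]) auto
  ultimately show ?thesis by simp
qed

lemma side_fixed:
  assumes h: "h \<in> W q J" and "\<And>v. v \<in> side q c \<Longrightarrow> h v = v" and "c \<le> k"
  shows "h (Y k) = Y k \<and> h (Z k) = Z k"
proof (cases "k \<le> q + 9")
  case True
  then show ?thesis using assms by (simp add: side_mem)
next
  case False
  then show ?thesis using W_outside_fix[OF h] Y_outside[of q k] by simp
qed

text \<open>As a is at most 2, the labels q + 3 and q + 4 both belong to the interval once b is at
  least q + 4, so \<open>cube q (q + 3)\<close> can undo a flip of the side. Only b = q + 6 needs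
  the finer matching.\<close>

lemma interval_path:
  assumes a: "a = 1 \<and> 3 \<le> b \<or> a = 2 \<and> 2 \<le> b" and b: "b \<le> q + 6"
    and gb: "g \<in> W q {..b}" and ga: "g \<in> W q {a..q + 7}"
  shows "g \<in> W q {a..b}"
proof -
  have fixed: "h \<in> W q {a..b}"
    if "h \<in> W q {..b}" "h \<in> W q {a..q + 7}" "\<And>v. v \<in> side q (b + 2) \<Longrightarrow> h v = v" for h
    by (rule interval_path_stripped[OF a b that(1,2)], rule side_fixed[OF that(1,3)]) auto
  have e: "cube q (q + 3) \<in> W q {a..b}" if "q + 4 \<le> b"
    using that a by (intro W_cube[of "q + 4"]) auto
  consider "b \<le> q + 3" | "b = q + 4" | "b = q + 5" | "b = q + 6" using b by linarith
  then show ?thesis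
  proof cases
    case 1
    then show ?thesis using right_fix[OF gb] by (intro interval_path_stripped[OF a b gb ga]) auto
  next
    case 2
    have "(\<forall>v\<in>side q (q + 6). g v = v) \<or> (\<forall>v\<in>side q (q + 6). g v = flip v)"
      by (rule right_side[OF gb]) (use 2 in simp)
    moreover have "b + 2 = q + 6" using 2 by simp
    ultimately consider "\<forall>v\<in>side q (b + 2). g v = v" | "\<forall>v\<in>side q (b + 2). g v = flip v" by metis
    then show ?thesis
    proof cases
      case 1
      then show ?thesis using fixed[OF gb ga] by blast
    next
      case s: 2
      show ?thesis
      proof (rule strip[OF gb ga _ e _ fixed])
        fix v assume v: "v \<in> side q (b + 2)"
        then have "g v = flip v" using s by blast
        then show "cube q (q + 3) (g v) = v" using v 2 by (auto simp: cube_q3 side_def)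
      qed (use 2 in auto)
    qed
  next
    case 3
    have "(\<forall>v\<in>side q (q + 7). g v = v) \<or> (\<forall>v\<in>side q (q + 7). g v = flip v)"
      by (rule right_side[OF gb]) (use 3 in simp)
    moreover have "b + 2 = q + 7" using 3 by simp
    ultimately consider "\<forall>v\<in>side q (b + 2). g v = v" | "\<forall>v\<in>side q (b + 2). g v = flip v" by metis
    then show ?thesis
    proof cases
      case 1
      then show ?thesis using fixed[OF gb ga] by blast
    next
      case s: 2
      show ?thesis
      proof (rule strip[OF gb ga _ e _ fixed])
        fix v assume v: "v \<in> side q (b + 2)"
        then have "g v = flip v" using s by blast
        then show "cube q (q + 3) (g v) = v" using v 3 by (auto simp: cube_q3 side_def)
      qed (use 3 in auto)
    qed
  next
    case 4
    have b2: "b + 2 = q + 8" using 4 by simp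
    obtain e where e: "e \<in> W q {a..b}" "\<And>v. v \<in> side q (b + 2) \<Longrightarrow> e (g v) = v"
      using side_match_q6[of g q a] gb ga unfolding 4 b2[unfolded 4] by blast
    show ?thesis by (rule strip[OF gb ga _ e fixed]) (use 4 in auto)
  qed
qed

section \<open>Coset enumeration for the two smallest initial segments\<close>

lemma schreier_cosets:
  assumes g: "g \<in> W q J" and id: "id \<in> C"
    and step: "\<And>k c. k \<in> J \<Longrightarrow> c \<in> C \<Longrightarrow> \<exists>c'\<in>C. \<exists>h\<in>W q K. rho q k \<circ> c = c' \<circ> h"
  shows "\<exists>c\<in>C. \<exists>h\<in>W q K. g = c \<circ> h"
  using g
proof (induction rule: W_induct)
  case id
  show ?case using assms(2) perm_subgroupD(1)[OF W_subgroup] by (metis comp_id)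
next
  case (step k g)
  then obtain c h where ch: "c \<in> C" "h \<in> W q K" "g = c \<circ> h" by blast
  then obtain c' h' where "c' \<in> C" "h' \<in> W q K" "rho q k \<circ> c = c' \<circ> h'" using assms(3)[OF step(1)] by blast
  then show ?case using ch W_comp[of h' q K h] by (metis comp_assoc)
qed

text \<open>These are the entries of the coset table with a nontrivial subgroup factor that do not
  follow from commutation or cancellation. Only six points are moved by labels 0 to 2, so each is a
  finite check.\<close>

lemma small_path_relations:
  fixes q :: nat
  defines "r0 \<equiv> rho q 0" and "r1 \<equiv> rho q 1" and "r2 \<equiv> rho q 2"
  shows "r0 (r1 (r0 (r1 (r0 v)))) = r1 (r0 (r1 (r0 (r1 v))))"
    and "r2 (r1 (r0 v)) = r0 (r1 (r0 (r2 (r1 (r2 v)))))"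
    and "r1 (r2 (r1 (r0 (r1 (r0 v))))) = r2 (r1 (r0 (r1 (r0 (r2 (r1 (r2 (r1 (r2 v)))))))))"
proof -
  have "v \<in> {P 1, P 2, P 3, P 4, Y 2, Y 3} \<or> (\<forall>k<3. rho q k v = v)"
    by (cases v) (auto simp: rho.simps)
  then consider "v \<in> {P 1, P 2, P 3, P 4, Y 2, Y 3}" | "rho q 0 v = v" "rho q 1 v = v" "rho q 2 v = v"
    by auto
  note c = this
  from c show "r0 (r1 (r0 (r1 (r0 v)))) = r1 (r0 (r1 (r0 (r1 v))))"
    unfolding r0_def r1_def r2_def by cases (auto simp: rho.simps)
  from c show "r2 (r1 (r0 v)) = r0 (r1 (r0 (r2 (r1 (r2 v)))))"
    unfolding r0_def r1_def r2_def by cases (auto simp: rho.simps)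
  from c show "r1 (r2 (r1 (r0 (r1 (r0 v))))) = r2 (r1 (r0 (r1 (r0 (r2 (r1 (r2 (r1 (r2 v)))))))))"
    unfolding r0_def r1_def r2_def by cases (auto simp: rho.simps)
qed

text \<open>Left coset representatives \<open>c\<close> of the stabiliser of \<open>P 1\<close>, obtained by walking along the path
  from \<open>P 1\<close>; the three relations above close up the coset table.\<close>

lemma interval_1_1:
  assumes g: "g \<in> W q {..1}" and P1: "g (P 1) = P 1"
  shows "g \<in> W q {1..1}"
proof -
  let ?r0 = "rho q 0" let ?r1 = "rho q 1"
  let ?C = "{id, ?r0, ?r1 \<circ> ?r0, ?r0 \<circ> ?r1 \<circ> ?r0, ?r1 \<circ> ?r0 \<circ> ?r1 \<circ> ?r0}"
  have one: "id \<in> W q {1..1}" by (rule perm_subgroupD(1)[OF W_subgroup])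
  have r1: "?r1 \<in> W q {1..1}" by (rule W_rho) simp
  note rel = small_path_relations(1)[of q]
  have "\<exists>c\<in>?C. \<exists>h\<in>W q {1..1}. g = c \<circ> h"
  proof (rule schreier_cosets[OF g])
    fix k c assume k: "k \<in> {..1::nat}" and c: "c \<in> ?C"
    have "\<exists>c'\<in>?C. \<exists>h\<in>{id, ?r1}. rho q k \<circ> c = c' \<circ> h"
    proof -
      have k: "k = 0 \<or> k = 1" using k by auto
      define c1 where "c1 = ?r0"
      define c2 where "c2 = ?r1 \<circ> ?r0"
      define c3 where "c3 = ?r0 \<circ> ?r1 \<circ> ?r0"
      define c4 where "c4 = ?r1 \<circ> ?r0 \<circ> ?r1 \<circ> ?r0"
      note defs = c1_def c2_def c3_def c4_def
      have "?r0 \<circ> id = c1 \<circ> id" "?r0 \<circ> c1 = id \<circ> id" "?r0 \<circ> c2 = c3 \<circ> id" "?r0 \<circ> c3 = c2 \<circ> id"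
          "?r0 \<circ> c4 = c4 \<circ> ?r1"
        by (simp_all add: fun_eq_iff defs rel del: One_nat_def)
      moreover have "?r1 \<circ> id = id \<circ> ?r1" "?r1 \<circ> c1 = c2 \<circ> id" "?r1 \<circ> c2 = c1 \<circ> id" "?r1 \<circ> c3 = c4 \<circ> id"
          "?r1 \<circ> c4 = c3 \<circ> id"
        by (simp_all add: fun_eq_iff defs del: One_nat_def)
      moreover have "c \<in> {id, c1, c2, c3, c4}" using c by (simp only: defs)
      ultimately have "\<exists>c'\<in>{id, c1, c2, c3, c4}. \<exists>h\<in>{id, ?r1}. rho q k \<circ> c = c' \<circ> h"
        using k by (elim disjE insertE emptyE) (hypsubst, blast)+
      then show ?thesis by (simp only: defs)
    qed
    then show "\<exists>c'\<in>?C. \<exists>h\<in>W q {1..1}. rho q k \<circ> c = c' \<circ> h" using one r1 by blast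
  qed simp
  then obtain c h where ch: "c \<in> ?C" "h \<in> W q {1..1}" "g = c \<circ> h" by blast
  have "h (P 1) = P 1" by (rule W_fix[OF ch(2)]) (simp add: rho.simps)
  then have "c (P 1) = P 1" using P1 ch(3) by simp
  \<comment> \<open>The representatives send \<open>P 1\<close> to the five distinct points of its
    path, so the one fixing \<open>P 1\<close> is \<open>id\<close>.\<close>
  then have "c = id" using ch(1) by (auto simp: rho.simps)
  then show ?thesis using ch by simp
qed

lemma interval_1_2:
  assumes g: "g \<in> W q {..2}" and P1: "g (P 1) = P 1"
  shows "g \<in> W q {1..2}"
proof -
  let ?r0 = "rho q 0" let ?r1 = "rho q 1" let ?r2 = "rho q 2"
  let ?C = "{id, ?r0, ?r1 \<circ> ?r0, ?r0 \<circ> ?r1 \<circ> ?r0, ?r1 \<circ> ?r0 \<circ> ?r1 \<circ> ?r0, ?r2 \<circ> ?r1 \<circ> ?r0 \<circ> ?r1 \<circ> ?r0}"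
  let ?H = "{id, ?r1, ?r2, ?r2 \<circ> ?r1 \<circ> ?r2, ?r2 \<circ> ?r1 \<circ> ?r2 \<circ> ?r1 \<circ> ?r2}"
  have r1: "?r1 \<in> W q {1..2}" and r2: "?r2 \<in> W q {1..2}" by (rule W_rho, simp)+
  have H: "?H \<subseteq> W q {1..2}"
    using r1 r2 perm_subgroupD(1)[OF W_subgroup] by (auto intro!: W_comp)
  note rel = small_path_relations[of q]
  have rel2: "?r2 (?r0 v) = ?r0 (?r2 v)" for v using rho_commute_point[of 0 2 q v] by simp
  \<comment> \<open>The subgroup factor \<open>?r2 \<circ> ?r1 \<circ> ?r2\<close> is an involution,
    so the second relation can also be read backwards.\<close>
  have rel3: "?r2 (?r0 (?r1 (?r0 v))) = ?r1 (?r0 (?r2 (?r1 (?r2 v))))" for v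
    using rel(2)[of "?r2 (?r1 (?r2 v))"] by (metis rho_rho)
  have "\<exists>c\<in>?C. \<exists>h\<in>W q {1..2}. g = c \<circ> h"
  proof (rule schreier_cosets[OF g])
    fix k c assume k: "k \<in> {..2::nat}" and c: "c \<in> ?C"
    have "\<exists>c'\<in>?C. \<exists>h\<in>?H. rho q k \<circ> c = c' \<circ> h"
    proof -
      have k: "k = 0 \<or> k = 1 \<or> k = 2" using k by auto
      define c1 where "c1 = ?r0"
      define c2 where "c2 = ?r1 \<circ> ?r0"
      define c3 where "c3 = ?r0 \<circ> ?r1 \<circ> ?r0"
      define c4 where "c4 = ?r1 \<circ> ?r0 \<circ> ?r1 \<circ> ?r0"
      define c5 where "c5 = ?r2 \<circ> ?r1 \<circ> ?r0 \<circ> ?r1 \<circ> ?r0"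
      define h3 where "h3 = ?r2 \<circ> ?r1 \<circ> ?r2"
      define h4 where "h4 = ?r2 \<circ> ?r1 \<circ> ?r2 \<circ> ?r1 \<circ> ?r2"
      note defs = c1_def c2_def c3_def c4_def c5_def h3_def h4_def
      have "?r0 \<circ> id = c1 \<circ> id" "?r0 \<circ> c1 = id \<circ> id" "?r0 \<circ> c2 = c3 \<circ> id" "?r0 \<circ> c3 = c2 \<circ> id"
          "?r0 \<circ> c4 = c4 \<circ> ?r1" "?r0 \<circ> c5 = c5 \<circ> ?r1"
        by (simp_all add: fun_eq_iff defs rel(1) rel2[symmetric] del: One_nat_def)
      moreover have "?r1 \<circ> id = id \<circ> ?r1" "?r1 \<circ> c1 = c2 \<circ> id" "?r1 \<circ> c2 = c1 \<circ> id" "?r1 \<circ> c3 = c4 \<circ> id"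
          "?r1 \<circ> c4 = c3 \<circ> id" "?r1 \<circ> c5 = c5 \<circ> h4"
        by (simp_all add: fun_eq_iff defs rel(3) del: One_nat_def)
      moreover have "?r2 \<circ> id = id \<circ> ?r2" "?r2 \<circ> c1 = c1 \<circ> ?r2" "?r2 \<circ> c4 = c5 \<circ> id" "?r2 \<circ> c5 = c4 \<circ> id"
        by (simp_all add: fun_eq_iff defs rel2 del: One_nat_def)
      moreover have "?r2 \<circ> c2 = c3 \<circ> h3" by (simp add: fun_eq_iff defs rel(2) del: One_nat_def)
      moreover have "?r2 \<circ> c3 = c2 \<circ> h3" by (simp add: fun_eq_iff defs rel3 del: One_nat_def)
      moreover have "c \<in> {id, c1, c2, c3, c4, c5}" using c by (simp only: defs)
      ultimately have "\<exists>c'\<in>{id, c1, c2, c3, c4, c5}. \<exists>h\<in>{id, ?r1, ?r2, h3, h4}. rho q k \<circ> c = c' \<circ> h"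
        using k by (elim disjE insertE emptyE) (hypsubst, blast)+
      then show ?thesis by (simp only: defs)
    qed
    then show "\<exists>c'\<in>?C. \<exists>h\<in>W q {1..2}. rho q k \<circ> c = c' \<circ> h" using H by blast
  qed simp
  then obtain c h where ch: "c \<in> ?C" "h \<in> W q {1..2}" "g = c \<circ> h" by blast
  have "h (P 1) = P 1" by (rule W_fix[OF ch(2)]) (auto simp: rho.simps)
  then have "c (P 1) = P 1" using P1 ch(3) by simp
  then have "c = id" using ch(1) by (auto simp: rho.simps)
  then show ?thesis using ch by simp
qed

section \<open>The group of the graph\<close>

lemma W_singleton: "g \<in> W q {k} \<Longrightarrow> g = id \<or> g = rho q k"
  by (induction rule: W_induct) (auto simp: rho_invol)

lemma interval_closed:
  assumes a: "1 \<le> a" "a \<le> q + 7" and b: "b \<le> q + 6"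
    and gb: "g \<in> W q {..b}" and ga: "g \<in> W q {a..q + 7}"
  shows "g \<in> W q {a..b}"
proof -
  have P1: "g (P 1) = P 1" by (rule left_fix_P1[OF ga a(1)])
  \<comment> \<open>The last three cases lack the labels that the linking argument needs; they rest
    on the fixed point \<open>P 1\<close>, by coset enumeration or directly.\<close>
  consider "3 \<le> a" | "a = 1 \<and> 3 \<le> b \<or> a = 2 \<and> 2 \<le> b" | "a = 1" "b = 2" | "a \<le> 2" "b = 1" | "a \<le> 2" "b = 0"
    using a(1) by linarith
  then show ?thesis
  proof cases
    case 1
    consider "b \<le> q + 3" | "b = q + 4" | "b = q + 5" | "b = q + 6" using b by linarith
    then show ?thesis
      using interval_left_block_small[OF 1 a(2) _ gb ga] interval_block_q4[OF 1 a(2) _ ga]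
        interval_block_q5[OF 1 a(2) _ ga] interval_block_q6[OF 1 a(2) _ ga] gb
      by cases auto
  next
    case 2
    then show ?thesis by (rule interval_path[OF _ b gb ga])
  next
    case 3
    then show ?thesis using interval_1_2[where g = g, OF _ P1] gb by simp
  next
    case 4
    then have g: "g \<in> W q {1..1}" using interval_1_1[where g = g, OF _ P1] gb by simp
    show ?thesis
    proof (cases "a = 1")
      case True
      then show ?thesis using g 4 by simp
    next
      case False
      then have "g (P 2) = P 2" using left_fix_P2[OF ga] 4 a by simp
      then have "g = id" using W_singleton[of g q 1] g by (auto simp: rho.simps)
      then show ?thesis using perm_subgroupD(1)[OF W_subgroup] by simp
    qed
  next
    case 5
    then have "g \<in> W q {0}" using gb by (simp add: atMost_0)
    then have "g = id" using W_singleton[of g q 0] P1 by (auto simp: rho.simps)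
    then show ?thesis using perm_subgroupD(1)[OF W_subgroup] by simp
  qed
qed

lemma W_wedge:
  assumes "a \<le> q + 8" "b \<le> q + 8"
  shows "W q {..<b} \<inter> W q {a..<q + 8} \<subseteq> W q {a..<b}"
proof
  fix g assume "g \<in> W q {..<b} \<inter> W q {a..<q + 8}"
  then have g: "g \<in> W q {..<b}" "g \<in> W q {a..<q + 8}" by auto
  have id: "id \<in> W q {a..<b}" by (rule perm_subgroupD(1)[OF W_subgroup])
  consider "a = 0" | "b = q + 8" | "a = q + 8" | "b = 0" | "1 \<le> a" "a \<le> q + 7" "1 \<le> b" "b \<le> q + 7"
    using assms by linarith
  then show "g \<in> W q {a..<b}"
  proof cases
    case 1
    then show ?thesis using g by (simp add: atLeast0LessThan)
  next
    case 3
    then have "g = id" using g(2) by (simp add: W_def words_empty)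
    then show ?thesis using id by simp
  next
    case 4
    then have "g = id" using g(1) by (simp add: W_def words_empty)
    then show ?thesis using id by simp
  next
    case 5
    have "{a..<q + 8} = {a..q + 7}" "{..<b} = {..b - 1}" "{a..<b} = {a..b - 1}" using 5 by auto
    then show ?thesis using interval_closed[OF 5(1,2), of "b - 1" g] g 5 by simp
  qed (use g in simp)
qed

lemma W_Int:
  assumes "J \<subseteq> {..<q + 8}" "K \<subseteq> {..<q + 8}"
  shows "W q J \<inter> W q K = W q (J \<inter> K)"
proof
  show "W q (J \<inter> K) \<subseteq> W q J \<inter> W q K" using W_mono[of "J \<inter> K"] by auto
  have "words (rho q ` J) \<inter> words (rho q ` K) \<subseteq> words (rho q ` (J \<inter> K))"
  proof (rule intersection_from_intervals[where r = "q + 8" and a = 0 and b = "q + 8"])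
    show "rho q i \<circ> rho q j = rho q j \<circ> rho q i" if "i + 2 \<le> j" "j < q + 8" for i j
      by (rule rho_commute[OF that])
    show "words (rho q ` {..<b}) \<inter> words (rho q ` {a..<q + 8}) \<subseteq> words (rho q ` {a..<b})"
      if "a \<le> q + 8" "b \<le> q + 8" for a b
      using W_wedge[OF that] by (simp add: W_def)
  qed (use assms rho_invol in auto)
  then show "W q J \<inter> W q K \<subseteq> W q (J \<inter> K)" by (simp add: W_def)
qed

lemma W_all: "W q {..<q + 8} = {p. p permutes verts49 (q + 8) \<and> evenperm p}"
  using all_even_perms W_permutes W_even by blast

section \<open>Passage to the groups of HOL-Algebra\<close>

lemma Sym_on_group: "group (Sym_on V)"
proof (rule groupI)
  fix x assume "x \<in> carrier (Sym_on V)"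
  then have "inv' x \<in> carrier (Sym_on V)" "inv' x \<circ> x = id"
    by (auto simp: Sym_on_def permutes_inv permutes_inv_o)
  then show "\<exists>y\<in>carrier (Sym_on V). y \<otimes>\<^bsub>Sym_on V\<^esub> x = \<one>\<^bsub>Sym_on V\<^esub>"
    by (auto simp: Sym_on_def)
qed (auto simp: Sym_on_def permutes_compose permutes_id comp_assoc)

text \<open>Stated for any group whose operation is composition, since it is used twice: in
  \<open>Sym_on\<close> to identify the carrier of \<open>G49 q\<close>, and inside
  \<open>G49 q\<close> for its subgroups.\<close>

lemma generate_words:
  assumes G: "group G" "monoid.mult G = (\<circ>)" "\<one>\<^bsub>G\<^esub> = id"
    and S: "S \<subseteq> carrier G" "\<And>s. s \<in> S \<Longrightarrow> s \<circ> s = id"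
  shows "generate G S = words S"
proof
  interpret group G by (rule G(1))
  show "generate G S \<subseteq> words S"
  proof
    fix g assume "g \<in> generate G S"
    then show "g \<in> words S"
    proof (induction rule: generate.induct)
      case one
      show ?case unfolding G by (rule words_id)
    next
      case (incl h)
      then show ?case by (rule words_base)
    next
      case (eng h1 h2)
      then show ?case unfolding G by (intro words_comp)
    next
      case (inv h)
      then have "inv\<^bsub>G\<^esub> h = h" using inv_equality[of h h] S G by auto
      then show ?case using inv by (simp add: words_base)
    qed
  qed
  show "words S \<subseteq> generate G S"
  proof
    fix g assume "g \<in> words S"
    then show "g \<in> generate G S"
    proof (induction rule: words.induct)
      case words_id
      show ?case using generate.one[of G S] unfolding G .
    next
      case (words_step s g)
      then show ?case using generate.eng[OF generate.incl[of s S G], of g] unfolding G by blast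
    qed
  qed
qed

abbreviation G49 :: "nat \<Rightarrow> (vtx \<Rightarrow> vtx) monoid" where
  "G49 q \<equiv> perm_group_of (verts49 (q + 8)) (edges49 (q + 8)) (q + 8)"

lemma label_perm_image: "J \<subseteq> {..<q + 8} \<Longrightarrow> label_perm (edges49 (q + 8)) ` J = rho q ` J"
  by (rule image_cong) (auto simp: label_perm_edges)

lemma G49_carrier: "carrier (G49 q) = W q {..<q + 8}"
proof -
  have "generate (Sym_on (verts49 (q + 8))) (rho q ` {..<q + 8}) = words (rho q ` {..<q + 8})"
    by (rule generate_words) (auto simp: Sym_on_group, auto simp: Sym_on_def rho_permutes rho_invol)
  then show ?thesis by (simp add: perm_group_of_def label_perm_image W_def)
qed

lemma G49_mult: "monoid.mult (G49 q) = (\<circ>)" and G49_one: "\<one>\<^bsub>G49 q\<^esub> = id"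
  by (simp_all add: perm_group_of_def Sym_on_def)

lemma G49_group: "group (G49 q)"
proof -
  interpret group "Sym_on (verts49 (q + 8))" by (rule Sym_on_group)
  have "subgroup (generate (Sym_on (verts49 (q + 8))) (rho q ` {..<q + 8})) (Sym_on (verts49 (q + 8)))"
    by (rule generate_is_subgroup) (auto simp: Sym_on_def rho_permutes)
  then show ?thesis unfolding perm_group_of_def
    by (simp add: subgroup_imp_group label_perm_image)
qed

lemma G49_generate:
  assumes "J \<subseteq> {..<q + 8}"
  shows "generate (G49 q) (label_perm (edges49 (q + 8)) ` J) = W q J"
  unfolding label_perm_image[OF assms] W_def
  by (rule generate_words[OF G49_group G49_mult G49_one])
    (use assms in \<open>auto simp: G49_carrier rho_invol intro: W_rho\<close>)

lemma G49_pow: "x [^]\<^bsub>G49 q\<^esub> (n::nat) = x ^^ n"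
proof -
  interpret group "G49 q" by (rule G49_group)
  show ?thesis
    by (induction n) (simp_all add: G49_mult G49_one funpow_swap1 fun_eq_iff)
qed

lemma rho_nontrivial:
  assumes "k < q + 8"
  shows "rho q k \<noteq> id"
proof -
  consider "k = 0" | "k = 1" | "k = 2" | "3 \<le> k" "k \<le> q + 7" using assms by linarith
  then obtain v where "rho q k v \<noteq> v"
  proof cases
    case 1 then show ?thesis using that[of "P 1"] by (simp add: rho.simps)
  next
    case 2 then show ?thesis using that[of "P 2"] by (simp add: rho.simps)
  next
    case 3 then show ?thesis using that[of "P 3"] by (simp add: rho.simps)
  next
    case 4 then show ?thesis using that[of "Y k"] by (simp add: rho_ge3 step_def)
  qed
  then show ?thesis by auto
qed

lemma G49_string_C_group: "string_C_group (G49 q) (label_perm (edges49 (q + 8))) (q + 8)"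
proof -
  have mem: "rho q k \<in> carrier (G49 q)" if "k < q + 8" for k
    unfolding G49_carrier by (rule W_rho) (use that in simp)
  have "((rho q i \<circ> rho q j) ^^ 2) = id" if "i + 2 \<le> j" "j < q + 8" for i j
  proof -
    have "(rho q i \<circ> rho q j) \<circ> (rho q i \<circ> rho q j) = id"
      using rho_commute_point[OF that] by (simp add: fun_eq_iff)
    then show ?thesis by (simp add: numeral_2_eq_2)
  qed
  then have "sggi (G49 q) (label_perm (edges49 (q + 8))) (q + 8)"
    unfolding sggi_def G49_mult G49_one G49_pow G49_generate[OF order.refl]
    using G49_group mem rho_nontrivial rho_invol by (auto simp: label_perm_edges G49_carrier)
  moreover have "intersection_property (G49 q) (label_perm (edges49 (q + 8))) (q + 8)"
    unfolding intersection_property_def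
    using G49_generate W_Int by (metis inf.coboundedI1)
  ultimately show ?thesis by (simp add: string_C_group_def)
qed

section \<open>Isomorphism with the alternating group\<close>

lemma card_verts49: "card (verts49 (q + 8)) = 2 * q + 19"
proof -
  have "card (Y ` {2..q + 9}) = q + 8" "card (Z ` {3..q + 9}) = q + 7"
    by (simp_all add: card_image inj_on_def)
  moreover have "card {P 1, P 2, P 3, P 4} = 4" by simp
  moreover have "card ({P 1, P 2, P 3, P 4} \<union> Y ` {2..q + 9}) = card {P 1, P 2, P 3, P 4} + card (Y ` {2..q + 9})"
    by (rule card_Un_disjoint) auto
  moreover have "card ({P 1, P 2, P 3, P 4} \<union> Y ` {2..q + 9} \<union> Z ` {3..q + 9})
      = card ({P 1, P 2, P 3, P 4} \<union> Y ` {2..q + 9}) + card (Z ` {3..q + 9})"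
    by (rule card_Un_disjoint) auto
  moreover have "q + 8 + 1 = q + 9" by simp
  ultimately show ?thesis unfolding verts49_def by (simp only:)
qed

text \<open>By \<open>W_all\<close> the carrier consists of all even permutations of the vertices.
  Relabelling along any bijection with \<open>{1..n}\<close> preserves composition and
  parity.\<close>

lemma G49_iso_alt: "G49 q \<cong> alt_group (2 * q + 19)"
proof -
  let ?V = "verts49 (q + 8)" let ?n = "2 * q + 19"
  obtain f where f: "bij_betw f ?V {1..?n}"
    using finite_same_card_bij[of ?V "{1..?n}"] card_verts49 by auto
  have inj: "inj_on f ?V" using f by (rule bij_betw_imp_inj_on)
  let ?g = "inv_into ?V f"
  have g: "bij_betw ?g {1..?n} ?V" using f by (rule bij_betw_inv_into)
  let ?h = "map_permutation ?V f"
  have alt: "carrier (alt_group ?n) = {p. p permutes {1..?n} \<and> evenperm p}"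
    using alt_group_carrier by auto
  have "?h \<in> hom (G49 q) (alt_group ?n)"
    unfolding hom_def
    using map_permutation_permutes[OF f] evenperm_map_permutation[OF inj] map_permutation_compose'[OF inj]
    by (auto simp: G49_carrier W_all alt G49_mult alt_group_mult)
  moreover have "bij_betw ?h (carrier (G49 q)) (carrier (alt_group ?n))"
  proof (rule bij_betw_byWitness[where f' = "map_permutation {1..?n} ?g"])
    show "\<forall>p\<in>carrier (G49 q). map_permutation {1..?n} ?g (?h p) = p"
      unfolding G49_carrier W_all
      using map_permutation_compose_inv[OF f] inv_into_f_f[OF inj] by auto
    show "\<forall>p\<in>carrier (alt_group ?n). ?h (map_permutation {1..?n} ?g p) = p"
      unfolding alt
      using map_permutation_compose_inv[OF g] bij_betw_inv_into_right[OF f] by auto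
    show "?h ` carrier (G49 q) \<subseteq> carrier (alt_group ?n)"
      unfolding G49_carrier W_all alt
      using map_permutation_permutes[OF f] evenperm_map_permutation[OF inj] by auto
    show "map_permutation {1..?n} ?g ` carrier (alt_group ?n) \<subseteq> carrier (G49 q)"
      unfolding G49_carrier W_all alt
      using map_permutation_permutes[OF g] evenperm_map_permutation[OF bij_betw_imp_inj_on[OF g]] by auto
  qed
  ultimately show ?thesis by (auto simp: is_iso_def iso_def)
qed

section \<open>Orders of products of neighbouring generators\<close>

lemma G49_ord_dvd:
  assumes "l = Suc k" "l < q + 8"
  shows "group.ord (G49 q) (rho q k \<circ> rho q l) dvd n \<longleftrightarrow> (rho q k \<circ> rho q l) ^^ n = id"
proof -
  have "rho q k \<circ> rho q l \<in> carrier (G49 q)"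
    unfolding G49_carrier by (intro W_comp W_rho) (use assms in auto)
  from group.pow_eq_id[OF G49_group this, of n] show ?thesis by (simp add: G49_pow G49_one)
qed

lemma G49_ord_prime:
  assumes k: "l = Suc k" "l < q + 8" and p: "Factorial_Ring.prime (p::nat)" and x: "(rho q k \<circ> rho q l) ^^ p = id"
    and v: "rho q k (rho q l v) \<noteq> v"
  shows "group.ord (G49 q) (rho q k \<circ> rho q l) = p"
proof -
  let ?o = "group.ord (G49 q) (rho q k \<circ> rho q l)"
  have "?o dvd p" using x G49_ord_dvd[OF k] by blast
  moreover have "\<not> ?o dvd 1"
    unfolding G49_ord_dvd[OF k] using v by (auto simp: fun_eq_iff)
  ultimately show ?thesis using p by (metis dvd_refl prime_nat_iff)
qed

lemma cube_funpow: "l = Suc k \<Longrightarrow> cube q k = (rho q k \<circ> rho q l) ^^ 3"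
  by (simp add: cube_def numeral_3_eq_3 comp_assoc)

text \<open>The point \<open>v\<close> is moved by the cube and \<open>w\<close> by the square,
  which excludes all proper divisors of 6.\<close>

lemma G49_ord_6:
  assumes k: "l = Suc k" "l < q + 8" and c: "cube q k \<circ> cube q k = id" "cube q k v \<noteq> v"
    and w: "rho q k (rho q l (rho q k (rho q l w))) \<noteq> w"
  shows "group.ord (G49 q) (rho q k \<circ> rho q l) = 6"
proof -
  let ?x = "rho q k \<circ> rho q l"
  let ?o = "group.ord (G49 q) ?x"
  have "?x ^^ (3 + 3) = id" unfolding funpow_add using c(1) by (simp only: cube_funpow[OF k(1)])
  then have 6: "?o dvd 6" unfolding G49_ord_dvd[OF k] by simp
  have 3: "\<not> ?o dvd 3"
    unfolding G49_ord_dvd[OF k] cube_funpow[OF k(1), symmetric] using c(2) by auto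
  have 2: "\<not> ?o dvd 2"
    unfolding G49_ord_dvd[OF k] using w by (auto simp: fun_eq_iff numeral_2_eq_2)
  have "?o \<le> 6" using 6 by (rule dvd_imp_le) simp
  moreover have "d dvd 6 \<Longrightarrow> \<not> d dvd 3 \<Longrightarrow> \<not> d dvd 2 \<Longrightarrow> d \<le> 6 \<Longrightarrow> d = 6" for d :: nat
  proof -
    assume d: "d dvd 6" "\<not> d dvd 3" "\<not> d dvd 2" "d \<le> 6"
    then have "d = 0 \<or> d = 1 \<or> d = 2 \<or> d = 3 \<or> d = 4 \<or> d = 5 \<or> d = 6" by linarith
    then show "d = 6" using d(1-3) by (elim disjE) simp_all
  qed
  ultimately show ?thesis using 6 3 2 by blast
qed

lemma flip_on_invol: "flip_on S \<circ> flip_on S = id"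
  by (simp add: flip_on_comp flip_on_empty)

text \<open>On a path of m points whose edges alternate between the two labels, the product is an
  m-cycle, so each order is the least common multiple of the path sizes. Labels 0, 1 and labels 1, 2
  give one path of five points. The sixes come from paths of three and two points, or at q + 4 from
  a path of six points across a rung. The last pair gives paths of four points.\<close>

lemma G49_orders:
  shows "group.ord (G49 q) (rho q 0 \<circ> rho q 1) = 5"
    and "group.ord (G49 q) (rho q 1 \<circ> rho q 2) = 5"
    and "group.ord (G49 q) (rho q 2 \<circ> rho q 3) = 6"
    and "3 \<le> k \<Longrightarrow> k < q + 3 \<Longrightarrow> group.ord (G49 q) (rho q k \<circ> rho q (k + 1)) = 3"
    and "group.ord (G49 q) (rho q (q + 3) \<circ> rho q (q + 4)) = 6"
    and "group.ord (G49 q) (rho q (q + 4) \<circ> rho q (q + 5)) = 6"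
    and "group.ord (G49 q) (rho q (q + 5) \<circ> rho q (q + 6)) = 6"
    and "group.ord (G49 q) (rho q (q + 6) \<circ> rho q (q + 7)) = 4"
proof -
  have five: "(f ^^ 5) v = f (f (f (f (f v))))" for f :: "vtx \<Rightarrow> vtx" and v
    by (simp add: eval_nat_numeral)
  show "group.ord (G49 q) (rho q 0 \<circ> rho q 1) = 5"
  proof (rule G49_ord_prime[where v = "P 1"])
    show "(rho q 0 \<circ> rho q 1) ^^ 5 = id"
      unfolding fun_eq_iff five by (simp add: small_path_relations(1)[symmetric] del: One_nat_def)
  qed (auto simp: rho.simps)
  show "group.ord (G49 q) (rho q 1 \<circ> rho q 2) = 5"
  proof (rule G49_ord_prime[where v = "P 2"])
    show "(rho q 1 \<circ> rho q 2) ^^ 5 = id"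
    proof
      fix v
      have "v \<in> {P 2, P 3, P 4, Y 2, Y 3} \<or> rho q 1 v = v \<and> rho q 2 v = v"
        by (cases v) (auto simp: rho.simps)
      then show "((rho q 1 \<circ> rho q 2) ^^ 5) v = id v"
        unfolding five by (auto simp: rho.simps)
    qed
  qed (auto simp: rho.simps)
  have "cube q 2 \<circ> cube q 2 = id" unfolding cube_2 by (auto simp: fun_eq_iff transpose_def)
  then show "group.ord (G49 q) (rho q 2 \<circ> rho q 3) = 6"
    by (intro G49_ord_6[where v = "P 3" and w = "Y 2"])
      (auto simp: cube_2 rho.simps step_def transpose_def)
  show "group.ord (G49 q) (rho q k \<circ> rho q (k + 1)) = 3" if k: "3 \<le> k" "k < q + 3"
  proof (rule G49_ord_prime[where v = "Y k"])
    have "(rho q k \<circ> rho q (k + 1)) ^^ 3 = cube q k" by (rule cube_funpow[symmetric]) simp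
    also have "cube q k = id"
    proof
      fix v
      show "cube q k v = id v"
        unfolding cube_def using k by (cases v) (auto simp: rho_lift transpose_def)
    qed
    finally show "(rho q k \<circ> rho q (k + 1)) ^^ 3 = id" .
  qed (use k in \<open>auto simp: rho_lift transpose_def\<close>)
  show "group.ord (G49 q) (rho q (q + 3) \<circ> rho q (q + 4)) = 6"
    by (rule G49_ord_6[where v = "Y (q + 9)" and w = "Y (q + 3)"])
      (auto simp: cube_q3 flip_on_invol rho_ge3 step_def)
  show "group.ord (G49 q) (rho q (q + 4) \<circ> rho q (q + 5)) = 6"
    by (rule G49_ord_6[where v = "Y (q + 9)" and w = "Y (q + 4)"])
      (auto simp: cube_q4 flip_on_invol rho_ge3 step_def)
  show "group.ord (G49 q) (rho q (q + 5) \<circ> rho q (q + 6)) = 6"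
    by (rule G49_ord_6[where v = "Y (q + 9)" and w = "Y (q + 5)"])
      (auto simp: cube_q5 rho_ge3 step_def lift_comp[symmetric] lift_id)
  have k: "q + 7 = Suc (q + 6)" "q + 7 < q + 8" by simp_all
  let ?x = "rho q (q + 6) \<circ> rho q (q + 7)"
  let ?o = "group.ord (G49 q) ?x"
  have four: "(f ^^ 4) v = f (f (f (f v)))" "(f ^^ 2) v = f (f v)" for f :: "vtx \<Rightarrow> vtx" and v
    by (simp_all add: eval_nat_numeral)
  have "?x ^^ 4 = id"
  proof
    fix v show "(?x ^^ 4) v = id v"
      unfolding four
    proof (cases v)
      case (Y j) then show "?x (?x (?x (?x v))) = id v"
        by (cases j q rule: index_cases) (simp_all add: rho_ge3 step_def)
    next
      case (Z j) then show "?x (?x (?x (?x v))) = id v"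
        by (cases j q rule: index_cases) (simp_all add: rho_ge3 step_def)
    qed (simp add: rho_ge3)
  qed
  then have o4: "?o dvd 4" unfolding G49_ord_dvd[OF k] .
  have "(?x ^^ 2) (Y (q + 6)) \<noteq> Y (q + 6)"
    unfolding four by (simp add: rho_ge3 step_def)
  then have o2: "\<not> ?o dvd 2" unfolding G49_ord_dvd[OF k] by (metis id_apply)
  have "?o \<le> 4" using o4 by (rule dvd_imp_le) simp
  moreover have "d dvd 4 \<Longrightarrow> \<not> d dvd 2 \<Longrightarrow> d \<le> 4 \<Longrightarrow> d = 4" for d :: nat
  proof -
    assume d: "d dvd 4" "\<not> d dvd 2" "d \<le> 4"
    then have "d = 0 \<or> d = 1 \<or> d = 2 \<or> d = 3 \<or> d = 4" by linarith
    then show "d = 4" using d(1,2) by (elim disjE) simp_all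
  qed
  ultimately show "?o = 4" using o4 o2 by blast
qed

lemma G49_schlafli:
  "schlafli (G49 q) (label_perm (edges49 (q + 8))) (q + 8)
     = [5, 5, 6] @ replicate q 3 @ [6, 6, 6, 4]" (is "?l = ?r")
proof (rule nth_equalityI)
  show "length ?l = length ?r" by (simp add: schlafli_def)
  fix i assume "i < length ?l"
  then have i: "i < q + 7" by (simp add: schlafli_def)
  \<comment> \<open>The list runs over \<open>[1..<r]\<close>, so position i holds the order for
    labels i and i + 1.\<close>
  have l: "?l ! i = group.ord (G49 q) (rho q i \<circ> rho q (i + 1))"
    using i by (simp add: schlafli_def G49_mult label_perm_edges)
  consider "i = 0" | "i = 1" | "i = 2" | "3 \<le> i" "i < q + 3" | "i = q + 3" | "i = q + 4" | "i = q + 5" | "i = q + 6"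
    using i by linarith
  then show "?l ! i = ?r ! i"
    unfolding l
  proof cases
    case 4
    then have "?r ! i = 3" by (simp add: nth_append nth_Cons')
    then show "group.ord (G49 q) (rho q i \<circ> rho q (i + 1)) = ?r ! i" using G49_orders(4)[OF 4] by simp
  next
    case 1
    then have "?r ! i = 5" "i = 0" "i + 1 = 1" by (simp_all add: nth_append nth_Cons')
    then show "group.ord (G49 q) (rho q i \<circ> rho q (i + 1)) = ?r ! i" using G49_orders(1)[of q] by metis
  next
    case 2
    then have "?r ! i = 5" "i = 1" "i + 1 = 2" by (simp_all add: nth_append nth_Cons')
    then show "group.ord (G49 q) (rho q i \<circ> rho q (i + 1)) = ?r ! i" using G49_orders(2)[of q] by metis
  next
    case 3
    then have "?r ! i = 6" "i = 2" "i + 1 = 3" by (simp_all add: nth_append nth_Cons')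
    then show "group.ord (G49 q) (rho q i \<circ> rho q (i + 1)) = ?r ! i" using G49_orders(3)[of q] by metis
  next
    case 5
    then have "?r ! i = 6" "i = q + 3" "i + 1 = q + 4" by (simp_all add: nth_append nth_Cons')
    then show "group.ord (G49 q) (rho q i \<circ> rho q (i + 1)) = ?r ! i" using G49_orders(5)[of q] by metis
  next
    case 6
    then have "?r ! i = 6" "i = q + 4" "i + 1 = q + 5" by (simp_all add: nth_append nth_Cons')
    then show "group.ord (G49 q) (rho q i \<circ> rho q (i + 1)) = ?r ! i" using G49_orders(6)[of q] by metis
  next
    case 7
    then have "?r ! i = 6" "i = q + 5" "i + 1 = q + 6" by (simp_all add: nth_append nth_Cons')
    then show "group.ord (G49 q) (rho q i \<circ> rho q (i + 1)) = ?r ! i" using G49_orders(7)[of q] by metis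
  next
    case 8
    then have "?r ! i = 4" "i = q + 6" "i + 1 = q + 7" by (simp_all add: nth_append nth_Cons')
    then show "group.ord (G49 q) (rho q i \<circ> rho q (i + 1)) = ?r ! i" using G49_orders(8)[of q] by metis
  qed
qed

theorem theorem4p9:
  fixes n :: nat
  assumes "n \<ge> 19" and "n mod 4 = 3"
  defines "r \<equiv> (n - 3) div 2"
  shows "card (verts49 r) = n
     \<and> perm_group_of (verts49 r) (edges49 r) r \<cong> alt_group n
     \<and> string_C_group (perm_group_of (verts49 r) (edges49 r) r) (label_perm (edges49 r)) r
     \<and> schlafli (perm_group_of (verts49 r) (edges49 r) r) (label_perm (edges49 r)) r
         = [5, 5, 6] @ replicate (r - 8) 3 @ [6, 6, 6, 4]"
proof -
  define q where "q = r - 8"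
  \<comment> \<open>The congruence makes n - 3 even, so the division in r is exact and n = 2 * r +
    3.\<close>
  have r: "r = q + 8" and n: "n = 2 * q + 19"
    using assms(1,2) unfolding q_def r_def by presburger+
  have "r - 8 = q" by (simp add: r)
  then show ?thesis
    using card_verts49[of q] G49_iso_alt[of q] G49_string_C_group[of q] G49_schlafli[of q]
    unfolding r n by simp
qed

end
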